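(* Assume that $a_i\not\equiv a_j\pmod{a_1}$ for all $i\ne j$ in $\{1,\dots,k\}$ and $a_i\not\equiv a_j\pmod{d-a_{k-1}}$ for all $i\neq j$ in $\{0,\dots,k-1\}$. Then $$a_1(K[S])<\frac{2d+\lambda_{\max}}{k}\left(1+\frac{a_{k-1}-a_1}{d}\right),$$ where $\lambda_{\max}=\max_{1\le i\le k}(a_i-a_{i-1}-1)$ is the largest gap. As a consequence, $$\mathrm{reg}(K[S])\le 1+\frac{2d+\lambda_{\max}}{k}\left(1+\frac{a_{k-1}-a_1}{d}\right).$$
   Context: Let $K$ be a field, $k\ge 3$, and let $0=:a_0<a_1<\cdots<a_k=:d$ be integers with $\gcd(a_1,\dots,a_k)=1$. Let $S\subset\mathbb N^2$ be the additive monoid generated by $(a_i,d-a_i)$, $0\le i\le k$, and $K[S]$ its semigroup ring (isomorphic to $K[s^{a_i}t^{d-a_i}\mid 0\le i\le k]$), graded by $\deg(u_1,u_2)=(u_1+u_2)/d$, with maximal homogeneous ideal $\mathfrak m$. Put $a_i(K[S])=\sup\{n\mid H^i_{\mathfrak m}(K[S])_n\ne0\}$ (with $\sup\emptyset=-\infty$; not to be confused with the integers $a_i$); the Castelnuovo--Mumford regularity is $\mathrm{reg}(K[S])=\max\{a_1(K[S])+1,\ a_2(K[S])+2\}$. *)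

theory Defs
  imports
    "HOL-Library.Poly_Mapping"
    "HOL-Library.Product_Plus"
    "HOL-Library.Function_Algebras"
    "HOL-Library.Extended_Real"
    "HOL-Number_Theory.Cong"
begin

section \<open>The Cech complex\<close>

text \<open>
  Here \<open>R\<close> is a subring of an ambient commutative ring in which \<open>f\<close> is a unit. Then \<open>localization R f\<close>
  is the set of all \<open>r / f ^ n\<close> with \<open>r\<close> in \<open>R\<close>, and it is isomorphic to the localization of \<open>R\<close> at the
  powers of \<open>f\<close>.
\<close>

definition localization :: "'a::comm_ring_1 set \<Rightarrow> 'a \<Rightarrow> 'a set" where
  "localization R f = {x. \<exists>n. x * f ^ n \<in> R}"

text \<open>
  The Cech complex of \<open>R\<close> on the sequence \<open>f 0, \<dots>, f k\<close>. In degree \<open>p\<close> it is the direct sum, over the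
  subsets \<open>I\<close> of \<open>{..k}\<close> with \<open>p\<close> elements, of the localizations of \<open>R\<close> at \<open>\<Prod>i\<in>I. f i\<close>; a cochain is
  extended by zero to all other sets \<open>I\<close>. Its cohomology is the local cohomology of \<open>R\<close> with support
  in the ideal generated by \<open>f 0, \<dots>, f k\<close>.
\<close>

definition cech_cochains ::
    "'a::comm_ring_1 set \<Rightarrow> (nat \<Rightarrow> 'a) \<Rightarrow> nat \<Rightarrow> nat \<Rightarrow> (nat set \<Rightarrow> 'a) set" where
  "cech_cochains R f k p =
     {c. \<forall>I. c I \<in> (if I \<subseteq> {..k} \<and> card I = p then localization R (\<Prod>i\<in>I. f i) else {0})}"

definition cech_diff :: "nat \<Rightarrow> (nat set \<Rightarrow> 'a::comm_ring_1) \<Rightarrow> (nat set \<Rightarrow> 'a)" where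
  "cech_diff k c =
     (\<lambda>J. if J \<subseteq> {..k} then \<Sum>j\<in>J. (- 1) ^ card {i \<in> J. i < j} * c (J - {j}) else 0)"

definition cech_cocycles ::
    "'a::comm_ring_1 set \<Rightarrow> (nat \<Rightarrow> 'a) \<Rightarrow> nat \<Rightarrow> nat \<Rightarrow> (nat set \<Rightarrow> 'a) set" where
  "cech_cocycles R f k p = {c \<in> cech_cochains R f k p. cech_diff k c = 0}"

definition cech_coboundaries ::
    "'a::comm_ring_1 set \<Rightarrow> (nat \<Rightarrow> 'a) \<Rightarrow> nat \<Rightarrow> nat \<Rightarrow> (nat set \<Rightarrow> 'a) set" where
  "cech_coboundaries R f k p =
     (case p of 0 \<Rightarrow> {0} | Suc q \<Rightarrow> cech_diff k ` cech_cochains R f k q)"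

text \<open>
  The classes in (cocycles / coboundaries) of the cocycles all of whose components lie in \<open>A\<close>. For
  \<open>A = UNIV\<close> this is the whole cohomology group, and for \<open>A\<close> the set of homogeneous elements of
  degree \<open>n\<close> it is its graded component of degree \<open>n\<close>. The zero class is \<open>cech_coboundaries R f k p\<close>.
\<close>

definition cech_cohomology ::
    "'a::comm_ring_1 set \<Rightarrow> (nat \<Rightarrow> 'a) \<Rightarrow> nat \<Rightarrow> nat \<Rightarrow> 'a set \<Rightarrow> (nat set \<Rightarrow> 'a) set set" where
  "cech_cohomology R f k p A =
     (\<lambda>c. (\<lambda>b. c + b) ` cech_coboundaries R f k p) ` {c \<in> cech_cocycles R f k p. \<forall>I. c I \<in> A}"

section \<open>The semigroup ring\<close>

inductive_set generated_monoid :: "'a::comm_monoid_add set \<Rightarrow> 'a set" for G where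
  zero: "0 \<in> generated_monoid G"
| add: "g \<in> G \<Longrightarrow> u \<in> generated_monoid G \<Longrightarrow> g + u \<in> generated_monoid G"

definition generator :: "(nat \<Rightarrow> int) \<Rightarrow> int \<Rightarrow> nat \<Rightarrow> int \<times> int" where
  "generator a d i = (a i, d - a i)"

definition curve_monoid :: "(nat \<Rightarrow> int) \<Rightarrow> int \<Rightarrow> nat \<Rightarrow> (int \<times> int) set" where
  "curve_monoid a d k = generated_monoid (generator a d ` {..k})"

text \<open>
  The semigroup ring \<open>K[S]\<close> is a subring of the group ring of \<open>\<int>\<^sup>2\<close>, that is, of the ring of Laurent
  polynomials in two variables over \<open>K\<close>. In the latter all monomials are units.
\<close>

definition semigroup_ring :: "(int \<times> int) set \<Rightarrow> ((int \<times> int) \<Rightarrow>\<^sub>0 'k::field) set" where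
  "semigroup_ring S = {p. Poly_Mapping.keys p \<subseteq> S}"

definition homogeneous :: "int \<Rightarrow> int \<Rightarrow> ((int \<times> int) \<Rightarrow>\<^sub>0 'k::field) set" where
  "homogeneous d n = {p. \<forall>u \<in> Poly_Mapping.keys p. fst u + snd u = d * n}"

definition maximal_ideal :: "(int \<times> int) set \<Rightarrow> ((int \<times> int) \<Rightarrow>\<^sub>0 'k::field) set" where
  "maximal_ideal S = {p \<in> semigroup_ring S. Poly_Mapping.lookup p 0 = 0}"

definition gen_monomial :: "(nat \<Rightarrow> int) \<Rightarrow> int \<Rightarrow> nat \<Rightarrow> ((int \<times> int) \<Rightarrow>\<^sub>0 'k::field)" where
  "gen_monomial a d i = Poly_Mapping.single (generator a d i) 1"

section \<open>Local cohomology and regularity\<close>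

text \<open>
  The local cohomology of \<open>K[S]\<close> with support in the maximal homogeneous ideal is computed by the Cech
  complex on the monomials \<open>gen_monomial a d i\<close>, \<open>i \<le> k\<close>. These generate the maximal homogeneous
  ideal and are units in the ambient Laurent polynomial ring (lemmas \<open>maximal_ideal_generated\<close> and
  \<open>gen_monomial_unit\<close> below).
\<close>

definition local_cohomology ::
    "(nat \<Rightarrow> int) \<Rightarrow> int \<Rightarrow> nat \<Rightarrow> nat \<Rightarrow> int \<Rightarrow> (nat set \<Rightarrow> (int \<times> int) \<Rightarrow>\<^sub>0 'k::field) set set" where
  "local_cohomology a d k p n =
     cech_cohomology (semigroup_ring (curve_monoid a d k)) (gen_monomial a d) k p (homogeneous d n)"

definition local_cohomology_zero ::
    "(nat \<Rightarrow> int) \<Rightarrow> int \<Rightarrow> nat \<Rightarrow> nat \<Rightarrow> (nat set \<Rightarrow> (int \<times> int) \<Rightarrow>\<^sub>0 'k::field) set set" where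
  "local_cohomology_zero a d k p =
     {cech_coboundaries (semigroup_ring (curve_monoid a d k)) (gen_monomial a d) k p}"

text \<open>The values \<open>\<infinity>\<close> and \<open>-\<infinity>\<close> are possible; in particular the supremum of the empty set is \<open>-\<infinity>\<close>.\<close>

definition a_invariant :: "'k::field itself \<Rightarrow> (nat \<Rightarrow> int) \<Rightarrow> int \<Rightarrow> nat \<Rightarrow> nat \<Rightarrow> ereal" where
  "a_invariant _ a d k p =
     Sup {ereal (of_int n) | n.
            (local_cohomology a d k p n :: (nat set \<Rightarrow> (int \<times> int) \<Rightarrow>\<^sub>0 'k) set set)
              \<noteq> local_cohomology_zero a d k p}"

definition regularity :: "'k::field itself \<Rightarrow> (nat \<Rightarrow> int) \<Rightarrow> int \<Rightarrow> nat \<Rightarrow> ereal" where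
  "regularity K a d k = max (a_invariant K a d k 1 + 1) (a_invariant K a d k 2 + 2)"

definition largest_gap :: "(nat \<Rightarrow> int) \<Rightarrow> nat \<Rightarrow> int" where
  "largest_gap a k = Max ((\<lambda>i. a i - a (i - 1) - 1) ` {1..k})"

section \<open>Consistency of the definitions\<close>

lemma gen_monomial_unit: "(gen_monomial a d i :: (int \<times> int) \<Rightarrow>\<^sub>0 'k::field) dvd 1"
proof -
  have "gen_monomial a d i * Poly_Mapping.single (- generator a d i) (1 :: 'k) = 1"
    by (simp add: gen_monomial_def mult_single)
  then show ?thesis by (metis dvd_triv_left)
qed

lemma curve_monoid_sum_nonneg:
  assumes "0 \<le> d" and "u \<in> curve_monoid a d k"
  shows "0 \<le> fst u + snd u"
  using assms(2) unfolding curve_monoid_def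
  by (induction) (use assms(1) in \<open>auto simp: generator_def zero_prod_def plus_prod_def\<close>)

lemma semigroup_ring_sum:
  assumes "\<And>i. i \<in> I \<Longrightarrow> p i \<in> semigroup_ring S"
  shows "(\<Sum>i\<in>I. p i) \<in> semigroup_ring S"
  using assms keys_sum[of p I] unfolding semigroup_ring_def by blast

lemma maximal_ideal_generated:
  assumes "0 < d"
  shows "(maximal_ideal (curve_monoid a d k) :: ((int \<times> int) \<Rightarrow>\<^sub>0 'k::field) set) =
    {\<Sum>i\<le>k. r i * gen_monomial a d i | r. \<forall>i\<le>k. r i \<in> semigroup_ring (curve_monoid a d k)}"
    (is "?M = ?J")
proof
  let ?S = "curve_monoid a d k"
  show "?J \<subseteq> ?M"
  proof
    fix p assume "p \<in> ?J"
    then obtain r where p: "p = (\<Sum>i\<le>k. r i * gen_monomial a d i)"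
      and r: "\<forall>i\<le>k. r i \<in> semigroup_ring ?S" by blast
    have *: "r i * gen_monomial a d i \<in> ?M" if "i \<le> k" for i
    proof -
      have "u \<in> ?S \<and> u \<noteq> 0" if uk: "u \<in> Poly_Mapping.keys (r i * gen_monomial a d i)" for u
      proof -
        have "Poly_Mapping.keys (gen_monomial a d i :: (int \<times> int) \<Rightarrow>\<^sub>0 'k) = {generator a d i}"
          by (simp add: gen_monomial_def)
        moreover obtain v w where "v \<in> Poly_Mapping.keys (r i)" "u = v + w"
            "w \<in> Poly_Mapping.keys (gen_monomial a d i :: (int \<times> int) \<Rightarrow>\<^sub>0 'k)"
          using subsetD[OF keys_mult uk] by blast
        ultimately obtain v where v: "v \<in> Poly_Mapping.keys (r i)" "u = generator a d i + v"
          by (auto simp: add.commute)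
        have vS: "v \<in> ?S" using v r \<open>i \<le> k\<close> by (auto simp: semigroup_ring_def)
        then have "u \<in> ?S"
          using v \<open>i \<le> k\<close> unfolding curve_monoid_def by (auto intro: generated_monoid.add)
        moreover have "fst u + snd u > 0"
          using v(2) curve_monoid_sum_nonneg[OF _ vS] assms by (simp add: generator_def)
        ultimately show ?thesis by auto
      qed
      then have "Poly_Mapping.keys (r i * gen_monomial a d i) \<subseteq> ?S"
        and "0 \<notin> Poly_Mapping.keys (r i * gen_monomial a d i)" by blast+
      then show ?thesis
        by (simp add: maximal_ideal_def semigroup_ring_def in_keys_iff)
    qed
    show "p \<in> ?M"
      using * semigroup_ring_sum[of "{..k}" "\<lambda>i. r i * gen_monomial a d i" ?S]
      unfolding p maximal_ideal_def by (simp add: lookup_sum)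
  qed
  show "?M \<subseteq> ?J"
  proof
    fix p :: "(int \<times> int) \<Rightarrow>\<^sub>0 'k" assume p: "p \<in> ?M"
    have "\<exists>i v. i \<le> k \<and> v \<in> ?S \<and> u = generator a d i + v"
      if u: "u \<in> Poly_Mapping.keys p" for u
    proof -
      have "u \<in> ?S" "u \<noteq> 0"
        using p u by (auto simp: maximal_ideal_def semigroup_ring_def in_keys_iff)
      then show ?thesis unfolding curve_monoid_def
        by (cases rule: generated_monoid.cases) auto
    qed
    then obtain i v where iv:
      "\<And>u. u \<in> Poly_Mapping.keys p \<Longrightarrow> i u \<le> k \<and> v u \<in> ?S \<and> u = generator a d (i u) + v u"
      by metis
    define r where
      "r = (\<lambda>j. \<Sum>u | u \<in> Poly_Mapping.keys p \<and> i u = j.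
              Poly_Mapping.single (v u) (Poly_Mapping.lookup p u))"
    have "r j \<in> semigroup_ring ?S" for j
      unfolding r_def using iv by (intro semigroup_ring_sum) (auto simp: semigroup_ring_def)
    moreover have "p = (\<Sum>j\<le>k. r j * gen_monomial a d j)"
    proof -
      have "p = (\<Sum>u \<in> Poly_Mapping.keys p. Poly_Mapping.single u (Poly_Mapping.lookup p u))"
        by (rule poly_mapping_eqI)
          (auto simp: lookup_sum lookup_single when_def in_keys_iff)
      also have "\<dots> = (\<Sum>j\<le>k. \<Sum>u | u \<in> Poly_Mapping.keys p \<and> i u = j.
                        Poly_Mapping.single u (Poly_Mapping.lookup p u))"
        using iv by (intro sum.group[symmetric]) auto
      also have "\<dots> = (\<Sum>j\<le>k. r j * gen_monomial a d j)"
      proof (rule sum.cong[OF refl])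
        fix j assume "j \<in> {..k}"
        have "Poly_Mapping.single u (Poly_Mapping.lookup p u) =
            Poly_Mapping.single (v u) (Poly_Mapping.lookup p u) * gen_monomial a d j"
          if "u \<in> Poly_Mapping.keys p" "i u = j" for u
          using iv[OF that(1)] that(2) by (simp add: gen_monomial_def mult_single add.commute)
        then show "(\<Sum>u | u \<in> Poly_Mapping.keys p \<and> i u = j.
              Poly_Mapping.single u (Poly_Mapping.lookup p u)) = r j * gen_monomial a d j"
          unfolding r_def sum_distrib_right by (intro sum.cong) auto
      qed
      finally show ?thesis .
    qed
    ultimately show "p \<in> ?J" by blast
  qed
qed

end

theory Submission
  imports Defs "HOL-Algebra.Elementary_Groups"
begin

text \<open>
  In degree \<open>n\<close>, \<open>H\<^sup>1\<close> vanishes unless some \<open>(u, v)\<close> outside \<open>S\<close> with \<open>u + v = d n\<close> has \<open>u\<close> in the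
  numerical semigroup generated by the \<open>a i\<close> and \<open>v\<close> in the one generated by the \<open>d - a i\<close>; \<open>H\<^sup>2\<close> vanishes
  unless some \<open>u\<close> and \<open>v\<close> with \<open>u + v = d n\<close> lie outside these semigroups. By Olson's inequality
  \<open>2 |X + B| \<ge> 2 |X| + |B|\<close> for generating \<open>B\<close>, fewer than \<open>2 a 1 / k\<close> generators suffice to reach every
  residue class modulo \<open>a 1\<close>, so the conductor of the first semigroup is about \<open>2 d a 1 / k - a 1\<close> (Selmer's bound).
  Subtracting copies of \<open>d\<close> and then one suitable generator brings any element close to the conductor,
  where it has at most \<open>(2 d + \<lambda>) / k\<close> summands because each of them is at least \<open>a 1 \<ge> k\<close>. If
  \<open>(u, v)\<close> is not in \<open>S\<close>, this number of summands bounds \<open>v\<close>, and by symmetry \<open>u\<close>.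
\<close>

section \<open>Growth of product sets in finite abelian groups\<close>

context comm_group
begin

lemma card_r_coset:
  assumes "X \<subseteq> carrier G" "g \<in> carrier G"
  shows "card (X #> g) = card X"
proof -
  have "X #> g = (\<lambda>x. x \<otimes> g) ` X" by (auto simp: r_coset_def)
  moreover have "inj_on (\<lambda>x. x \<otimes> g) X" using assms by (intro inj_onI) (meson right_cancel subsetD)
  ultimately show ?thesis by (simp add: card_image)
qed

lemma subset_set_mult:
  assumes "X \<subseteq> carrier G" "\<one> \<in> B"
  shows "X \<subseteq> X <#> B"
  using assms unfolding set_mult_def by force

lemma set_mult_Un: "(X \<union> Y) <#> B = (X <#> B) \<union> (Y <#> B)"
  by (auto simp: set_mult_def)

lemma set_mult_Int_subset: "(X \<inter> Y) <#> B \<subseteq> (X <#> B) \<inter> (Y <#> B)"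
  by (auto simp: set_mult_def)

text \<open>Take for \<open>Y\<close> the inverses of the complement of \<open>X <#> B\<close>. An
  equation \<open>inv x = inv z \<otimes> b\<close> would give \<open>z = x \<otimes> b\<close>, so
  \<open>Y <#> B\<close> misses the inverses of \<open>X\<close>. Hence passing to \<open>Y\<close>
  does not increase the growth \<open>card (X <#> B) - card X\<close>.\<close>

lemma ex_dual_set:
  assumes fin: "finite (carrier G)" and B: "B \<subseteq> carrier G"
    and X: "X \<subseteq> carrier G" "X \<noteq> {}" "X <#> B \<noteq> carrier G"
  obtains Y where "Y \<subseteq> carrier G" "Y \<noteq> {}" "Y <#> B \<noteq> carrier G"
    "card Y + card (X <#> B) = card (carrier G)"
    "card (Y <#> B) + card X \<le> card (carrier G)"
proof
  let ?XB = "X <#> B" and ?Y = "m_inv G ` (carrier G - (X <#> B))"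
  have XB: "?XB \<subseteq> carrier G" using X(1) B by (rule set_mult_closed)
  show Y: "?Y \<subseteq> carrier G" by auto
  show "?Y \<noteq> {}" using XB X(3) by auto
  have inj: "inj_on (m_inv G) (carrier G)"
    by (rule inj_onI) (metis inv_inv)
  have "card ?Y = card (carrier G - ?XB)"
    by (rule card_image) (rule inj_on_subset[OF inj], auto)
  also have "\<dots> = card (carrier G) - card ?XB"
    using XB fin by (simp add: card_Diff_subset finite_subset)
  finally show "card ?Y + card ?XB = card (carrier G)"
    using card_mono[OF fin XB] by simp
  have disj: "(?Y <#> B) \<inter> (m_inv G ` X) = {}"
  proof (rule ccontr)
    assume "(?Y <#> B) \<inter> (m_inv G ` X) \<noteq> {}"
    then obtain z b x where z: "z \<in> carrier G" "z \<notin> ?XB" and b: "b \<in> B" and x: "x \<in> X"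
      and e: "inv x = inv z \<otimes> b" by (auto simp: set_mult_def)
    have c: "b \<in> carrier G" "x \<in> carrier G" using b x B X(1) by auto
    have "b = z \<otimes> inv x" using e z c by (metis inv_solve_left' inv_closed)
    then have "x \<otimes> b = z" using z c by (metis inv_solve_right m_comm)
    then show False using z b x by (auto simp: set_mult_def)
  qed
  have sub: "?Y <#> B \<subseteq> carrier G" using Y B by (rule set_mult_closed)
  have iX: "m_inv G ` X \<subseteq> carrier G" using X(1) by auto
  show "?Y <#> B \<noteq> carrier G" using disj iX X(2) by blast
  have "card (?Y <#> B) + card (m_inv G ` X) = card ((?Y <#> B) \<union> (m_inv G ` X))"
    using disj fin sub iX by (simp add: card_Un_disjoint finite_subset)
  also have "\<dots> \<le> card (carrier G)"
    using fin sub iX by (intro card_mono) auto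
  finally show "card (?Y <#> B) + card X \<le> card (carrier G)"
    using card_image[OF inj_on_subset[OF inj X(1)]] by simp
qed

text \<open>Hamidoune's argument: a smallest minimizer (an atom) is equal to or disjoint from each of its
  translates, by submodularity of \<open>X \<mapsto> card (X <#> B)\<close>. So it is a coset of a subgroup. Duality handles the case
  where the product of \<open>B\<close> with the union of two translates is the whole group.\<close>

lemma ex_subgroup_min_growth:
  assumes fin: "finite (carrier G)" and B: "B \<subseteq> carrier G" and one: "\<one> \<in> B"
    and X0: "X0 \<subseteq> carrier G" "X0 \<noteq> {}" "X0 <#> B \<noteq> carrier G"
  obtains H where "subgroup H G" "H <#> B \<noteq> carrier G"
    "card (H <#> B) + card X0 \<le> card (X0 <#> B) + card H"
proof -
  define adm where "adm X \<longleftrightarrow> X \<subseteq> carrier G \<and> X \<noteq> {} \<and> X <#> B \<noteq> carrier G" for X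
  define \<delta> where "\<delta> X = card (X <#> B) - card X" for X
  have sub: "X <#> B \<subseteq> carrier G" if "X \<subseteq> carrier G" for X
    using that B by (rule set_mult_closed)
  have fin': "finite X" if "X \<subseteq> carrier G" for X using that fin finite_subset by blast
  have \<delta>: "card (X <#> B) = card X + \<delta> X" if "X \<subseteq> carrier G" for X
    using card_mono[OF fin'[OF sub[OF that]] subset_set_mult[OF that one]] by (simp add: \<delta>_def)
  obtain X1 where X1: "adm X1" "\<And>Y. adm Y \<Longrightarrow> \<delta> X1 \<le> \<delta> Y"
    using ex_has_least_nat[of adm X0 \<delta>] X0 unfolding adm_def by blast
  obtain X where X: "adm X" "\<delta> X = \<delta> X1" and Xmin: "\<And>Y. adm Y \<Longrightarrow> \<delta> Y = \<delta> X1 \<Longrightarrow> card X \<le> card Y"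
    using ex_has_least_nat[of "\<lambda>Y. adm Y \<and> \<delta> Y = \<delta> X1" X1 card] X1 by blast
  define \<kappa> where "\<kappa> = \<delta> X1"
  have X': "X \<subseteq> carrier G" "X \<noteq> {}" "X <#> B \<noteq> carrier G" using X(1) by (auto simp: adm_def)
  \<comment> \<open>The dual set grows by at most \<open>\<kappa>\<close>, so it is a minimizer too
    and at least as large as \<open>X\<close>; its size is
    \<open>card (carrier G) - card X - \<kappa>\<close>.\<close>
  have small: "2 * card X + \<kappa> \<le> card (carrier G)"
  proof -
    obtain Y where Y: "Y \<subseteq> carrier G" "Y \<noteq> {}" "Y <#> B \<noteq> carrier G"
      "card Y + card (X <#> B) = card (carrier G)" "card (Y <#> B) + card X \<le> card (carrier G)"
      using ex_dual_set[OF fin B X'] .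
    have "adm Y" using Y by (simp add: adm_def)
    moreover have "\<delta> Y \<le> \<kappa>" using Y(4,5) \<delta>[OF Y(1)] \<delta>[OF X'(1)] X(2) \<kappa>_def by linarith
    ultimately have "card X \<le> card Y" using X1(2) Xmin \<kappa>_def by (metis le_antisym)
    then show ?thesis using Y(4) \<delta>[OF X'(1)] X(2) \<kappa>_def by linarith
  qed
  have atoms: "X = Y" if Y: "adm Y" "\<delta> Y = \<kappa>" "card Y = card X" and ne: "X \<inter> Y \<noteq> {}" for Y
  proof -
    let ?P = "X \<inter> Y" and ?U = "X \<union> Y"
    have Yc: "Y \<subseteq> carrier G" using Y(1) by (simp add: adm_def)
    have PXY: "?P <#> B \<subseteq> (X <#> B) \<inter> (Y <#> B)" by (rule set_mult_Int_subset)
    have Padm: "adm ?P"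
      using ne X' Yc PXY sub[OF X'(1)] unfolding adm_def by blast
    have P: "?P \<subseteq> carrier G" and U: "?U \<subseteq> carrier G" using X'(1) Yc by auto
    have cP: "card (?P <#> B) = card ?P + \<delta> ?P" using \<delta>[OF P] .
    have cX: "card (X <#> B) = card X + \<kappa>" "card (Y <#> B) = card X + \<kappa>"
      using \<delta>[OF X'(1)] \<delta>[OF Yc] X(2) Y by (auto simp: \<kappa>_def)
    have "card (X <#> B) + card (Y <#> B) = card (?U <#> B) + card ((X <#> B) \<inter> (Y <#> B))"
      unfolding set_mult_Un
      by (rule card_Un_Int) (use fin' sub X'(1) Yc in auto)
    moreover have "card (?P <#> B) \<le> card ((X <#> B) \<inter> (Y <#> B))"
      by (rule card_mono[OF _ PXY]) (use fin' sub X'(1) in auto)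
    ultimately have le: "card (?U <#> B) + card (?P <#> B) \<le> 2 * card X + 2 * \<kappa>"
      using cX by linarith
    have uP: "card X + card Y = card ?U + card ?P"
      by (rule card_Un_Int) (use fin' X'(1) Yc in auto)
    have \<delta>P: "\<kappa> \<le> \<delta> ?P" using X1(2)[OF Padm] \<kappa>_def by simp
    have cPpos: "card ?P > 0" using ne fin'[OF P] by (simp add: card_gt_0_iff)
    \<comment> \<open>A full product would force
      \<open>card (carrier G) + card ?P \<le> 2 * card X + \<kappa>\<close>, against
      \<open>small\<close> because \<open>?P\<close> is not empty.\<close>
    have Unot: "?U <#> B \<noteq> carrier G"
      using le cP \<delta>P cPpos small by auto
    have "adm ?U" using U X'(2) Unot by (simp add: adm_def)
    then have "\<kappa> \<le> \<delta> ?U" using X1(2) \<kappa>_def by simp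
    \<comment> \<open>The growths of \<open>?P\<close> and \<open>?U\<close> add up to at most
      \<open>2 * \<kappa>\<close>, and neither is below \<open>\<kappa>\<close>.\<close>
    then have "\<delta> ?P = \<kappa>" using le cP \<delta>P \<delta>[OF U] uP Y(3) by linarith
    then have "card X \<le> card ?P" using Xmin Padm \<kappa>_def by simp
    then have "?P = X" "?P = Y"
      using card_seteq[OF fin'[OF X'(1)], of ?P] card_seteq[OF fin'[OF Yc], of ?P] Y(3) by auto
    then show ?thesis by simp
  qed
  have trans: "adm (Z #> g) \<and> \<delta> (Z #> g) = \<delta> Z \<and> card (Z #> g) = card Z"
    if Z: "adm Z" and g: "g \<in> carrier G" for Z g
  proof -
    have Zc: "Z \<subseteq> carrier G" using Z by (simp add: adm_def)
    have e: "(Z #> g) <#> B = (Z <#> B) #> g"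
    proof -
      have "(Z #> g) <#> B = Z <#> (g <# B)" using Zc B g by (rule rcos_assoc_lcos)
      also have "g <# B = B #> g" using B g by (auto simp: l_coset_def r_coset_def m_comm subset_iff)
      also have "Z <#> (B #> g) = (Z <#> B) #> g" using Zc B g by (simp add: setmult_rcos_assoc)
      finally show ?thesis .
    qed
    have c: "card (Z #> g) = card Z" "card ((Z #> g) <#> B) = card (Z <#> B)"
      using card_r_coset Zc g sub[OF Zc] e by auto
    have "card (Z <#> B) < card (carrier G)"
      using Z sub[OF Zc] fin psubset_card_mono unfolding adm_def by blast
    moreover have "Z #> g \<noteq> {}" using Z unfolding adm_def r_coset_def by auto
    moreover have "Z #> g \<subseteq> carrier G" using Zc g by (rule r_coset_subset_G)
    ultimately show ?thesis using c unfolding adm_def \<delta>_def by auto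
  qed
  obtain x0 where x0: "x0 \<in> X" using X'(2) by blast
  define H where "H = X #> inv x0"
  have x0c: "x0 \<in> carrier G" using x0 X'(1) by auto
  have H: "adm H" "\<delta> H = \<kappa>" "card H = card X"
    using trans[OF X(1), of "inv x0"] x0c X(2) \<kappa>_def by (auto simp: H_def)
  have Hc: "H \<subseteq> carrier G" using H(1) by (simp add: adm_def)
  have oneH: "\<one> \<in> H" using x0 x0c unfolding H_def r_coset_def by force
  \<comment> \<open>The atoms \<open>X\<close> and \<open>H #> inv h #> x0\<close> share the element
    \<open>x0\<close>, so they coincide. Closure of \<open>H\<close> under inverses and products is
    read off from this invariance.\<close>
  have coset: "H #> inv h = H" if h: "h \<in> H" for h
  proof -
    have hc: "h \<in> carrier G" using h Hc by auto
    let ?g = "inv h"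
    have "X = H #> x0"
      unfolding H_def using X'(1) x0c by (simp add: coset_mult_assoc coset_mult_one)
    moreover have "x0 \<in> H #> x0" using oneH x0c unfolding r_coset_def by force
    moreover have "x0 \<in> H #> ?g #> x0"
      using h hc x0c unfolding r_coset_def by force
    ultimately have ne: "X \<inter> (H #> ?g #> x0) \<noteq> {}" by auto
    have "adm (H #> ?g #> x0) \<and> \<delta> (H #> ?g #> x0) = \<kappa> \<and> card (H #> ?g #> x0) = card X"
      using trans[OF H(1), of ?g] trans[of "H #> ?g" x0] hc x0c H by auto
    then have "X = H #> ?g #> x0" using atoms ne by blast
    then have "X #> inv x0 = H #> ?g #> x0 #> inv x0" by simp
    also have "\<dots> = H #> ?g"
      using Hc hc x0c by (simp add: coset_mult_assoc coset_mult_one m_assoc)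
    finally show ?thesis by (simp add: H_def)
  qed
  have inv_in: "inv h \<in> H" if h: "h \<in> H" for h
  proof -
    have "\<one> \<otimes> inv h \<in> H #> inv h" using oneH unfolding r_coset_def by blast
    then show ?thesis using coset[OF h] h Hc by auto
  qed
  have "subgroup H G"
  proof (rule subgroupI)
    show "H \<subseteq> carrier G" "H \<noteq> {}" using Hc oneH by auto
    show "inv h \<in> H" if "h \<in> H" for h using inv_in that .
    show "h \<otimes> h' \<in> H" if "h \<in> H" "h' \<in> H" for h h'
    proof -
      have "h \<otimes> h' \<in> H #> h'" using that unfolding r_coset_def by blast
      then show ?thesis using coset[OF inv_in[OF that(2)]] that Hc by auto
    qed
  qed
  moreover have "H <#> B \<noteq> carrier G" using H(1) by (simp add: adm_def)
  moreover have "card (H <#> B) + card X0 \<le> card (X0 <#> B) + card H"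
    using \<delta>[OF Hc] H(2) \<delta>[OF X0(1)] X1(2)[of X0] X0 \<kappa>_def by (simp add: adm_def)
  ultimately show ?thesis using that by blast
qed

text \<open>It suffices to bound the growth of a subgroup \<open>H\<close>. A generating
  \<open>B\<close> is not contained in \<open>H\<close>, so \<open>H <#> B\<close> contains
  \<open>H\<close> and a second coset and has at least \<open>2 * card H\<close> elements; it also
  contains \<open>B\<close>. So twice its growth is at least \<open>card (H <#> B)\<close>, hence at
  least \<open>card B\<close>.\<close>

theorem card_set_mult_ge:
  assumes fin: "finite (carrier G)" and B: "B \<subseteq> carrier G" and one: "\<one> \<in> B"
    and gen: "\<And>H. subgroup H G \<Longrightarrow> B \<subseteq> H \<Longrightarrow> H = carrier G"
    and X: "X \<subseteq> carrier G" "X \<noteq> {}" "X <#> B \<noteq> carrier G"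
  shows "2 * card X + card B \<le> 2 * card (X <#> B)"
proof -
  obtain H where H: "subgroup H G" "H <#> B \<noteq> carrier G"
    "card (H <#> B) + card X \<le> card (X <#> B) + card H"
    using ex_subgroup_min_growth[OF fin B one X] .
  have Hc: "H \<subseteq> carrier G" using H(1) by (rule subgroup.subset)
  have HB: "H <#> B \<subseteq> carrier G" using Hc B by (rule set_mult_closed)
  have "\<not> B \<subseteq> H"
  proof
    assume "B \<subseteq> H"
    then have "H = carrier G" using gen H(1) by blast
    then show False using H(2) HB subset_set_mult[OF Hc one] by auto
  qed
  then obtain b where b: "b \<in> B" "b \<notin> H" by blast
  have bc: "b \<in> carrier G" using b B by auto
  have disj: "H \<inter> (H #> b) = {}"
    using repr_independence[OF _ bc H(1)] rcos_self[OF bc H(1)] b(2) H(1)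
    by (metis Int_emptyI Hc subgroup.rcos_const subset_iff group_axioms)
  have "card H + card (H #> b) = card (H \<union> (H #> b))"
    using disj Hc bc fin r_coset_subset_G[OF Hc bc] by (simp add: card_Un_disjoint finite_subset)
  also have "\<dots> \<le> card (H <#> B)"
  proof (rule card_mono)
    show "finite (H <#> B)" using HB fin finite_subset by blast
    show "H \<union> (H #> b) \<subseteq> H <#> B"
      using subset_set_mult[OF Hc one] b(1) by (auto simp: r_coset_def set_mult_def)
  qed
  finally have "2 * card H \<le> card (H <#> B)" using card_r_coset[OF Hc bc] by simp
  moreover have "card B \<le> card (H <#> B)"
  proof (rule card_mono)
    show "finite (H <#> B)" using HB fin finite_subset by blast
    show "B \<subseteq> H <#> B"
      using B subgroup.one_closed[OF H(1)] unfolding set_mult_def by force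
  qed
  ultimately show ?thesis using H(3) by linarith
qed

text \<open>The first factor gives all of \<open>card B\<close> and each further one at least half
  of it, so \<open>j\<close> factors give \<open>Suc j * card B / 2\<close> elements unless the
  group is exhausted.\<close>

corollary card_set_mult_iterate:
  assumes fin: "finite (carrier G)" and B: "B \<subseteq> carrier G" and one: "\<one> \<in> B"
    and gen: "\<And>H. subgroup H G \<Longrightarrow> B \<subseteq> H \<Longrightarrow> H = carrier G"
    and big: "2 * card (carrier G) \<le> Suc j * card B"
  shows "((\<lambda>X. X <#> B) ^^ j) {\<one>} = carrier G"
proof -
  let ?P = "\<lambda>j. ((\<lambda>X. X <#> B) ^^ j) {\<one>}"
  have PB: "?P j \<subseteq> carrier G \<and> ?P j \<noteq> {}" for j
    using B one by (induction j) (auto simp: set_mult_def subset_iff)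
  have step: "?P j = carrier G \<or> Suc j * card B \<le> 2 * card (?P j)" if "j > 0" for j
    using that
  proof (induction j rule: nat_induct_non_zero)
    case 1
    have "?P 1 = B" using B by (force simp: set_mult_def)
    then show ?case by simp
  next
    case (Suc j)
    have eq: "?P (Suc j) = ?P j <#> B" by simp
    show ?case
    proof (cases "?P (Suc j) = carrier G")
      case False
      have "?P j \<noteq> carrier G"
        using False subset_set_mult[OF _ one, of "?P j"] PB[of "Suc j"] PB[of j] eq by auto
      then have "Suc j * card B \<le> 2 * card (?P j)" using Suc.IH by blast
      moreover have "2 * card (?P j) + card B \<le> 2 * card (?P j <#> B)"
        using card_set_mult_ge[OF fin B one gen] PB[of j] False eq by simp
      ultimately show ?thesis using eq by simp
    qed simp
  qed
  show ?thesis
  proof (cases "j = 0")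
    case True
    have "card (carrier G) \<ge> 1" using fin by (simp add: Suc_leI card_gt_0_iff carrier_not_empty)
    moreover have "card B \<le> card (carrier G)" using B fin by (simp add: card_mono)
    ultimately show ?thesis using big True by simp
  next
    case False
    then show ?thesis
      using step[of j] PB[of j] big card_seteq[OF fin, of "?P j"] by force
  qed
qed

end

section \<open>Closure properties of the curve monoid\<close>

lemma curve_monoid_add:
  assumes "u \<in> curve_monoid a d k" "w \<in> curve_monoid a d k"
  shows "u + w \<in> curve_monoid a d k"
  using assms unfolding curve_monoid_def
  by (induction rule: generated_monoid.induct) (auto simp: add.assoc intro: generated_monoid.add)

lemma curve_monoid_multiple:
  assumes "i \<le> k"
  shows "(int N * a i, int N * (d - a i)) \<in> curve_monoid a d k"
proof (induction N)
  case 0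
  then show ?case
    using generated_monoid.zero[of "generator a d ` {..k}"] by (simp add: curve_monoid_def zero_prod_def)
next
  case (Suc N)
  have "generator a d i + (int N * a i, int N * (d - a i)) \<in> curve_monoid a d k"
    using Suc assms unfolding curve_monoid_def by (intro generated_monoid.add) auto
  then show ?case by (simp add: generator_def algebra_simps)
qed

section \<open>Localizations of semigroup rings at monomials\<close>

lemma lookup_times_single:
  fixes p :: "'a::ab_group_add \<Rightarrow>\<^sub>0 'b::comm_ring_1"
  shows "Poly_Mapping.lookup (p * Poly_Mapping.single g 1) (u + g) = Poly_Mapping.lookup p u"
proof -
  let ?K = "Poly_Mapping.keys p" and ?l = "Poly_Mapping.lookup p"
  have "p = (\<Sum>v\<in>?K. Poly_Mapping.single v (?l v))"
    by (rule poly_mapping_eqI) (auto simp: lookup_sum lookup_single when_def in_keys_iff)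
  then have "p * Poly_Mapping.single g 1
      = (\<Sum>v\<in>?K. Poly_Mapping.single v (?l v)) * Poly_Mapping.single g 1" by simp
  also have "\<dots> = (\<Sum>v\<in>?K. Poly_Mapping.single (v + g) (?l v))"
    by (simp add: sum_distrib_right mult_single)
  finally show ?thesis by (auto simp: lookup_sum lookup_single when_def in_keys_iff)
qed

lemma keys_times_single:
  fixes p :: "'a::ab_group_add \<Rightarrow>\<^sub>0 'b::comm_ring_1"
  shows "Poly_Mapping.keys (p * Poly_Mapping.single g 1) = (\<lambda>u. u + g) ` Poly_Mapping.keys p"
proof (rule Set.set_eqI)
  fix w
  have "w \<in> Poly_Mapping.keys (p * Poly_Mapping.single g 1) \<longleftrightarrow> w - g \<in> Poly_Mapping.keys p"
    using lookup_times_single[of p g "w - g"] by (simp add: in_keys_iff)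
  also have "\<dots> \<longleftrightarrow> w \<in> (\<lambda>u. u + g) ` Poly_Mapping.keys p"
    by (metis (no_types, lifting) add_diff_cancel diff_add_cancel image_iff)
  finally show "w \<in> Poly_Mapping.keys (p * Poly_Mapping.single g 1) \<longleftrightarrow> \<dots>" .
qed

lemma prod_gen_monomial:
  "(\<Prod>i\<in>I. gen_monomial a d i) = (Poly_Mapping.single (\<Sum>i\<in>I. generator a d i) 1 :: _ \<Rightarrow>\<^sub>0 'k::field)"
  by (induction I rule: infinite_finite_induct) (auto simp: gen_monomial_def mult_single)

definition nat_mul :: "nat \<Rightarrow> int \<times> int \<Rightarrow> int \<times> int" where
  "nat_mul N g = (int N * fst g, int N * snd g)"

lemma nat_mul_add: "nat_mul (M + N) g = nat_mul M g + nat_mul N g"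
  by (simp add: nat_mul_def distrib_right)

lemma single_power:
  "Poly_Mapping.single g 1 ^ N = (Poly_Mapping.single (nat_mul N g) 1 :: _ \<Rightarrow>\<^sub>0 'k::field)"
proof (induction N)
  case 0
  then show ?case by (simp add: nat_mul_def flip: zero_prod_def)
next
  case (Suc N)
  have "g + nat_mul N g = nat_mul (Suc N) g"
    by (simp add: nat_mul_def distrib_right prod_eq_iff)
  then show ?case using Suc by (simp add: mult_single)
qed

text \<open>The monoid \<open>S - \<nat> g\<close>, in which \<open>g\<close> is inverted. When
  \<open>g\<close> is a sum of distinct generators, these are the exponents that occur in the
  localization of the semigroup ring, by \<open>localization_iff\<close>.\<close>

definition monoid_localization :: "(int \<times> int) set \<Rightarrow> int \<times> int \<Rightarrow> (int \<times> int) set" where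
  "monoid_localization S g = {u. \<exists>N. u + nat_mul N g \<in> S}"

lemma nat_mul_generator: "i \<le> k \<Longrightarrow> nat_mul N (generator a d i) \<in> curve_monoid a d k"
  using curve_monoid_multiple[of i k N a d] by (simp add: nat_mul_def generator_def)

lemma nat_mul_sum_generator:
  "I \<subseteq> {..k} \<Longrightarrow> nat_mul N (\<Sum>i\<in>I. generator a d i) \<in> curve_monoid a d k"
proof (induction I rule: infinite_finite_induct)
  case (insert i I)
  have "nat_mul N (\<Sum>i\<in>insert i I. generator a d i)
      = nat_mul N (generator a d i) + nat_mul N (\<Sum>i\<in>I. generator a d i)"
    using insert by (simp add: nat_mul_def distrib_left)
  then show ?case using insert by (auto intro!: curve_monoid_add nat_mul_generator)
qed (use nat_mul_generator[of 0 k 0 a d] in \<open>auto simp: nat_mul_def\<close>)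

text \<open>A Laurent polynomial has finitely many exponents, so one power of the monomial serves
  them all: the sum of the individual powers is large enough, and raising a power does no harm
  because multiples of \<open>?g\<close> lie in the monoid.\<close>

lemma localization_iff:
  assumes I: "I \<subseteq> {..k}"
  shows "(p :: _ \<Rightarrow>\<^sub>0 'k::field) \<in>
      localization (semigroup_ring (curve_monoid a d k)) (\<Prod>i\<in>I. gen_monomial a d i)
    \<longleftrightarrow> Poly_Mapping.keys p \<subseteq> monoid_localization (curve_monoid a d k) (\<Sum>i\<in>I. generator a d i)"
    (is "_ \<longleftrightarrow> _ \<subseteq> monoid_localization ?S ?g")
proof -
  have "(\<exists>N. \<forall>u\<in>Poly_Mapping.keys p. u + nat_mul N ?g \<in> ?S) \<longleftrightarrow>
      (\<forall>u\<in>Poly_Mapping.keys p. \<exists>N. u + nat_mul N ?g \<in> ?S)" (is "?L \<longleftrightarrow> ?R")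
  proof
    assume ?R
    then obtain N where N: "\<And>u. u \<in> Poly_Mapping.keys p \<Longrightarrow> u + nat_mul (N u) ?g \<in> ?S" by metis
    define M where "M = (\<Sum>u\<in>Poly_Mapping.keys p. N u)"
    have "u + nat_mul M ?g \<in> ?S" if u: "u \<in> Poly_Mapping.keys p" for u
    proof -
      have "N u \<le> M" unfolding M_def using u by (intro member_le_sum) auto
      then obtain L where "M = N u + L" using le_Suc_ex by blast
      then have eq: "u + nat_mul M ?g = (u + nat_mul (N u) ?g) + nat_mul L ?g"
        by (simp add: nat_mul_add add.assoc)
      show ?thesis
        unfolding eq by (rule curve_monoid_add[OF N[OF u] nat_mul_sum_generator[OF I]])
    qed
    then show ?L by blast
  qed blast
  moreover have "p \<in> localization (semigroup_ring ?S) (\<Prod>i\<in>I. gen_monomial a d i)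
      \<longleftrightarrow> (\<exists>N. \<forall>u\<in>Poly_Mapping.keys p. u + nat_mul N ?g \<in> ?S)"
    by (simp add: localization_def semigroup_ring_def prod_gen_monomial single_power
        keys_times_single image_subset_iff)
  ultimately show ?thesis by (auto simp: monoid_localization_def)
qed

section \<open>Cochains and cohomology classes\<close>

lemma cech_cochains_iff:
  "c \<in> cech_cochains (semigroup_ring (curve_monoid a d k)) (gen_monomial a d) k p \<longleftrightarrow>
    (\<forall>I. Poly_Mapping.keys (c I :: _ \<Rightarrow>\<^sub>0 'k::field) \<subseteq>
      (if I \<subseteq> {..k} \<and> card I = p then monoid_localization (curve_monoid a d k) (\<Sum>i\<in>I. generator a d i)
       else {}))"
proof -
  have "c I \<in> (if I \<subseteq> {..k} \<and> card I = p
        then localization (semigroup_ring (curve_monoid a d k)) (\<Prod>i\<in>I. gen_monomial a d i) else {0})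
    \<longleftrightarrow> Poly_Mapping.keys (c I) \<subseteq> (if I \<subseteq> {..k} \<and> card I = p
        then monoid_localization (curve_monoid a d k) (\<Sum>i\<in>I. generator a d i) else {})" for I
    using localization_iff[of I k "c I" a d] by auto
  then show ?thesis by (simp add: cech_cochains_def)
qed

lemma cech_cochains_eq_0:
  assumes "c \<in> cech_cochains R f k p" "\<not> (J \<subseteq> {..k} \<and> card J = p)"
  shows "c J = 0"
proof -
  have "c J \<in> (if J \<subseteq> {..k} \<and> card J = p then localization R (\<Prod>i\<in>J. f i) else {0})"
    using assms(1) unfolding cech_cochains_def by blast
  then show ?thesis using assms(2) by (simp only: if_False singleton_iff)
qed

lemma cech_diff_add: "cech_diff k (b + c) = cech_diff k b + cech_diff k c"
  by (rule ext) (simp add: cech_diff_def distrib_left sum.distrib)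

lemma cech_diff_uminus: "cech_diff k (- c) = - cech_diff k c"
  by (rule ext) (simp add: cech_diff_def sum_negf)

text \<open>Coboundaries form a group, so the coset of a coboundary is the zero class. If every
  homogeneous cocycle were a coboundary, only the zero class would remain.\<close>

lemma local_cohomology_nonzeroE:
  assumes "(local_cohomology a d k (Suc q) n :: (nat set \<Rightarrow> _ \<Rightarrow>\<^sub>0 'k::field) set set)
    \<noteq> local_cohomology_zero a d k (Suc q)"
  obtains c :: "nat set \<Rightarrow> _ \<Rightarrow>\<^sub>0 'k::field"
    where "c \<in> cech_cochains (semigroup_ring (curve_monoid a d k)) (gen_monomial a d) k (Suc q)"
      "cech_diff k c = 0" "\<forall>I. c I \<in> homogeneous d n"
      "c \<notin> cech_diff k ` cech_cochains (semigroup_ring (curve_monoid a d k)) (gen_monomial a d) k q"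
proof -
  let ?C = "cech_cochains (semigroup_ring (curve_monoid a d k)) (gen_monomial a d) k
    :: nat \<Rightarrow> (nat set \<Rightarrow> _ \<Rightarrow>\<^sub>0 'k) set"
  let ?B = "cech_diff k ` ?C q"
  let ?Z = "{c \<in> ?C (Suc q). cech_diff k c = 0 \<and> (\<forall>I. c I \<in> homogeneous d n)}"
  have add: "b + c \<in> ?C q" if "b \<in> ?C q" "c \<in> ?C q" for b c
    unfolding cech_cochains_iff
  proof
    fix I
    have "Poly_Mapping.keys ((b + c) I) \<subseteq> Poly_Mapping.keys (b I) \<union> Poly_Mapping.keys (c I)"
      using keys_add[of "b I" "c I"] by simp
    also have "\<dots> \<subseteq> (if I \<subseteq> {..k} \<and> card I = q
        then monoid_localization (curve_monoid a d k) (\<Sum>i\<in>I. generator a d i) else {})"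
      using that unfolding cech_cochains_iff by (meson Un_least)
    finally show "Poly_Mapping.keys ((b + c) I) \<subseteq> (if I \<subseteq> {..k} \<and> card I = q
        then monoid_localization (curve_monoid a d k) (\<Sum>i\<in>I. generator a d i) else {})" .
  qed
  have uminus: "- b \<in> ?C q" if "b \<in> ?C q" for b
    using that unfolding cech_cochains_iff by (simp add: keys_minus)
  have coset: "(\<lambda>b. c + b) ` ?B = ?B" if c: "c \<in> ?B" for c
  proof -
    have 1: "x + y \<in> ?B" if "x \<in> ?B" "y \<in> ?B" for x y
      using that add by (auto simp flip: cech_diff_add)
    have 2: "- x \<in> ?B" if "x \<in> ?B" for x
      using that uminus by (auto simp flip: cech_diff_uminus)
    show ?thesis
    proof
      show "(\<lambda>b. c + b) ` ?B \<subseteq> ?B" using 1[OF c] by (rule image_subsetI)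
      show "?B \<subseteq> (\<lambda>b. c + b) ` ?B"
      proof
        fix y assume "y \<in> ?B"
        then have "- c + y \<in> ?B" using 1[OF 2[OF c]] by blast
        then show "y \<in> (\<lambda>b. c + b) ` ?B" by (rule rev_image_eqI) simp
      qed
    qed
  qed
  \<comment> \<open>Without any cocycle the set of classes would be empty instead of
    \<open>{?B}\<close>.\<close>
  have "0 \<in> ?Z"
    by (auto simp: cech_cochains_iff cech_diff_def homogeneous_def fun_eq_iff)
  have "\<exists>c\<in>?Z. c \<notin> ?B"
  proof (rule ccontr)
    assume "\<not> (\<exists>c\<in>?Z. c \<notin> ?B)"
    then have "(\<lambda>c. (\<lambda>b. c + b) ` ?B) ` ?Z = {?B}"
      using coset \<open>0 \<in> ?Z\<close> by blast
    moreover have "local_cohomology a d k (Suc q) n = (\<lambda>c. (\<lambda>b. c + b) ` ?B) ` ?Z"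
      by (auto simp: local_cohomology_def cech_cohomology_def cech_cocycles_def
          cech_coboundaries_def intro!: image_cong)
    ultimately show False
      using assms by (simp add: local_cohomology_zero_def cech_coboundaries_def)
  qed
  then show ?thesis using that by blast
qed

section \<open>The Cech differential in low degrees\<close>

lemma cech_diff_insert1:
  assumes "j \<le> k"
  shows "cech_diff k c {j} = c {}"
proof -
  have *: "{x \<in> {j}. x < j} = {}" by auto
  have "cech_diff k c {j} = (- 1) ^ card {x \<in> {j}. x < j} * c ({j} - {j})"
    using assms unfolding cech_diff_def by simp
  then show ?thesis unfolding * by simp
qed

lemma cech_diff_insert2:
  assumes "i < j" "j \<le> k"
  shows "cech_diff k c {i, j} = c {j} - c {i}"
proof -
  have *: "{x \<in> {i, j}. x < i} = {}" "{x \<in> {i, j}. x < j} = {i}" "{i, j} - {i} = {j}" "{i, j} - {j} = {i}"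
    using assms by auto
  have "cech_diff k c {i, j} = (- 1) ^ card {x \<in> {i, j}. x < i} * c ({i, j} - {i})
      + (- 1) ^ card {x \<in> {i, j}. x < j} * c ({i, j} - {j})"
    using assms unfolding cech_diff_def by simp
  then show ?thesis unfolding * by simp
qed

lemma cech_diff_insert3:
  assumes "i < j" "j < l" "l \<le> k"
  shows "cech_diff k c {i, j, l} = c {j, l} - c {i, l} + c {i, j}"
proof -
  have *: "{x \<in> {i, j, l}. x < i} = {}" "{x \<in> {i, j, l}. x < j} = {i}" "{x \<in> {i, j, l}. x < l} = {i, j}"
    "{i, j, l} - {i} = {j, l}" "{i, j, l} - {j} = {i, l}" "{i, j, l} - {l} = {i, j}"
    using assms by auto
  have "cech_diff k c {i, j, l} = (- 1) ^ card {x \<in> {i, j, l}. x < i} * c ({i, j, l} - {i})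
      + ((- 1) ^ card {x \<in> {i, j, l}. x < j} * c ({i, j, l} - {j})
      + (- 1) ^ card {x \<in> {i, j, l}. x < l} * c ({i, j, l} - {l}))"
    using assms unfolding cech_diff_def by simp
  then show ?thesis unfolding * using assms by simp
qed

lemma cech_diff_eq_0:
  assumes "\<And>j. j \<in> J \<Longrightarrow> c (J - {j}) = 0"
  shows "cech_diff k c J = 0"
  using assms by (simp add: cech_diff_def)

text \<open>The cocycle condition on the pairs \<open>{0, i}\<close> makes all components of a
  1-cocycle equal. The exponents of the common value lie in the localizations at the generators
  \<open>0\<close> and \<open>k\<close>, hence by \<open>incl\<close> in the monoid. Placed at the
  empty set, this value is a 0-cochain with the required coboundary.\<close>

lemma local_cohomology_1_zero:
  assumes k: "0 < k"
    and incl: "\<And>w. \<lbrakk>fst w + snd w = d * n;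
      w \<in> monoid_localization (curve_monoid a d k) (generator a d 0);
      w \<in> monoid_localization (curve_monoid a d k) (generator a d k)\<rbrakk> \<Longrightarrow> w \<in> curve_monoid a d k"
  shows "(local_cohomology a d k 1 n :: (nat set \<Rightarrow> _ \<Rightarrow>\<^sub>0 'k::field) set set)
    = local_cohomology_zero a d k 1"
proof (rule ccontr)
  assume "\<not> ?thesis"
  then have "(local_cohomology a d k (Suc 0) n :: (nat set \<Rightarrow> _ \<Rightarrow>\<^sub>0 'k) set set)
    \<noteq> local_cohomology_zero a d k (Suc 0)" by simp
  then obtain c :: "nat set \<Rightarrow> _ \<Rightarrow>\<^sub>0 'k"
    where c: "c \<in> cech_cochains (semigroup_ring (curve_monoid a d k)) (gen_monomial a d) k (Suc 0)"
      and dc: "cech_diff k c = 0" and hom: "\<forall>I. c I \<in> homogeneous d n"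
      and nb: "c \<notin> cech_diff k ` cech_cochains (semigroup_ring (curve_monoid a d k)) (gen_monomial a d) k 0"
    by (rule local_cohomology_nonzeroE)
  have eq: "c {i} = c {0}" if "i \<le> k" for i
  proof (cases "i = 0")
    case False
    then show ?thesis using cech_diff_insert2[of 0 i k c] dc that by simp
  qed simp
  have keys: "Poly_Mapping.keys (c {i}) \<subseteq> monoid_localization (curve_monoid a d k) (generator a d i)"
    if "i \<le> k" for i
    using c that unfolding cech_cochains_iff by (force dest: spec[of _ "{i}"])
  have keys0: "Poly_Mapping.keys (c {0}) \<subseteq> curve_monoid a d k"
    using incl keys[of 0] keys[of k] eq[of k] spec[OF hom, of "{0}"] by (auto simp: homogeneous_def subset_iff)
  define b where "b = (\<lambda>I :: nat set. if I = {} then c {0} else 0 :: _ \<Rightarrow>\<^sub>0 'k)"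
  have "curve_monoid a d k \<subseteq> monoid_localization (curve_monoid a d k) 0"
    by (auto simp: monoid_localization_def nat_mul_def simp flip: zero_prod_def)
  then have bC: "b \<in> cech_cochains (semigroup_ring (curve_monoid a d k)) (gen_monomial a d) k 0"
    using keys0 unfolding cech_cochains_iff b_def by auto
  have "cech_diff k b J = c J" for J
  proof (cases "J \<subseteq> {..k} \<and> card J = 1")
    case True
    then obtain j where "J = {j}" "j \<le> k" by (auto simp: card_1_singleton_iff)
    then show ?thesis using eq[of j] by (simp add: cech_diff_insert1 b_def)
  next
    case False
    then have "c J = 0" by (intro cech_cochains_eq_0[OF c]) simp
    moreover have "cech_diff k b J = 0"
    proof (cases "J \<subseteq> {..k}")
      case True
      have "J - {j} \<noteq> {}" if "j \<in> J" for j
      proof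
        assume "J - {j} = {}"
        then have "J = {j}" using that by auto
        then show False using False True by simp
      qed
      then show ?thesis by (intro cech_diff_eq_0) (simp add: b_def)
    qed (simp add: cech_diff_def)
    ultimately show ?thesis by simp
  qed
  then have "cech_diff k b = c" by (rule ext)
  then show False using nb bC by blast
qed

text \<open>Cutting down to the exponents in \<open>U\<close> respects the cocycle identities, so
  the parts of a cocycle inside and outside \<open>U\<close> can be contracted separately.\<close>

lift_definition restrict_keys :: "'a set \<Rightarrow> ('a \<Rightarrow>\<^sub>0 'b::zero) \<Rightarrow> ('a \<Rightarrow>\<^sub>0 'b)"
  is "\<lambda>U f u. f u when u \<in> U"
  by (erule finite_subset[rotated]) (auto simp: when_def)

lemma keys_restrict_keys: "Poly_Mapping.keys (restrict_keys U p) = Poly_Mapping.keys p \<inter> U"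
  by (auto simp: in_keys_iff restrict_keys.rep_eq when_def split: if_splits)

lemma restrict_keys_split:
  "restrict_keys U p + restrict_keys (- U) p = (p :: 'a \<Rightarrow>\<^sub>0 'b::comm_monoid_add)"
  by (rule poly_mapping_eqI) (simp add: lookup_add restrict_keys.rep_eq when_def)

lemma restrict_keys_diff:
  "restrict_keys U (p - q) = restrict_keys U p - restrict_keys U (q :: 'a \<Rightarrow>\<^sub>0 'b::ab_group_add)"
  by (rule poly_mapping_eqI) (simp add: lookup_minus restrict_keys.rep_eq when_def)

text \<open>For an interior generator \<open>g\<close>, the multiple \<open>d * g\<close> is a combination of the two extremal
  generators with positive coefficients, so inverting \<open>g\<close> inverts them too.\<close>

lemma monoid_localization_interior:
  assumes a: "a 0 = 0" "a k = d" "0 < a i" "a i < d" and i: "i \<le> k" and j: "j = 0 \<or> j = k"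
  shows "monoid_localization (curve_monoid a d k) (generator a d i + generator a d j)
    \<subseteq> monoid_localization (curve_monoid a d k) (generator a d i)"
proof
  fix w assume "w \<in> monoid_localization (curve_monoid a d k) (generator a d i + generator a d j)"
  then obtain N where N: "w + nat_mul N (generator a d i + generator a d j) \<in> curve_monoid a d k"
    by (auto simp: monoid_localization_def)
  \<comment> \<open>Writing \<open>g\<close> for the generators,
    \<open>d * g i = a i * g k + (d - a i) * g 0\<close>. One copy of \<open>g j\<close> is already
    present; \<open>x\<close> and \<open>y\<close> count the copies of \<open>g k\<close> and
    \<open>g 0\<close> still missing.\<close>
  define x where "x = a i - (if j = k then 1 else 0)"
  define y where "y = d - a i - (if j = k then 0 else 1)"
  have xy: "0 \<le> x" "0 \<le> y" using a by (auto simp: x_def y_def)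
  have "(w + nat_mul N (generator a d i + generator a d j))
      + (nat_mul (N * nat x) (generator a d k) + nat_mul (N * nat y) (generator a d 0)) \<in> curve_monoid a d k"
    by (rule curve_monoid_add[OF N], rule curve_monoid_add; rule nat_mul_generator) (use i in auto)
  moreover have "(w + nat_mul N (generator a d i + generator a d j))
      + (nat_mul (N * nat x) (generator a d k) + nat_mul (N * nat y) (generator a d 0))
    = w + nat_mul (N + N * nat d) (generator a d i)"
    using xy a j by (auto simp: prod_eq_iff nat_mul_def generator_def x_def y_def algebra_simps)
  ultimately show "w \<in> monoid_localization (curve_monoid a d k) (generator a d i)"
    by (auto simp: monoid_localization_def)
qed

text \<open>The complex is contracted with vertex \<open>k\<close> on the monomials that lie in the localization at
  generator \<open>0\<close>, and with vertex \<open>0\<close> on the others.\<close>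

lemma local_cohomology_2_zero:
  assumes k: "0 < k" and a: "a 0 = 0" "a k = d" "\<And>i. 0 < i \<Longrightarrow> i < k \<Longrightarrow> 0 < a i \<and> a i < d"
    and cover: "\<And>w. fst w + snd w = d * n \<Longrightarrow>
      w \<in> monoid_localization (curve_monoid a d k) (generator a d 0) \<or>
      w \<in> monoid_localization (curve_monoid a d k) (generator a d k)"
  shows "(local_cohomology a d k 2 n :: (nat set \<Rightarrow> _ \<Rightarrow>\<^sub>0 'k::field) set set)
    = local_cohomology_zero a d k 2"
proof (rule ccontr)
  let ?L = "monoid_localization (curve_monoid a d k)"
  assume "\<not> ?thesis"
  then have "(local_cohomology a d k (Suc 1) n :: (nat set \<Rightarrow> _ \<Rightarrow>\<^sub>0 'k) set set)
    \<noteq> local_cohomology_zero a d k (Suc 1)" by (simp add: numeral_2_eq_2)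
  then obtain c :: "nat set \<Rightarrow> _ \<Rightarrow>\<^sub>0 'k"
    where c: "c \<in> cech_cochains (semigroup_ring (curve_monoid a d k)) (gen_monomial a d) k (Suc 1)"
      and dc: "cech_diff k c = 0" and hom: "\<forall>I. c I \<in> homogeneous d n"
      and nb: "c \<notin> cech_diff k ` cech_cochains (semigroup_ring (curve_monoid a d k)) (gen_monomial a d) k 1"
    by (rule local_cohomology_nonzeroE)
  have keys: "Poly_Mapping.keys (c {i, j}) \<subseteq> ?L (generator a d i + generator a d j)"
    if "i \<noteq> j" "i \<le> k" "j \<le> k" for i j
    using c that unfolding cech_cochains_iff by (force dest: spec[of _ "{i, j}"])
  define U where "U = ?L (generator a d 0)"
  \<comment> \<open>The primitives \<open>- c {i, k}\<close> and \<open>c {0, i}\<close> of the two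
    contractions, cut down to \<open>U\<close> and to its complement, with zero for the degenerate
    index. The support is correct at vertex \<open>0\<close> by the choice of \<open>U\<close>, at
    vertex \<open>k\<close> by \<open>cover\<close>, and elsewhere by
    \<open>monoid_localization_interior\<close>.\<close>
  define \<beta> where "\<beta> i = (if i < k then - restrict_keys U (c {i, k}) else 0)
    + (if 0 < i then restrict_keys (- U) (c {0, i}) else 0)" for i
  have \<beta>: "Poly_Mapping.keys (\<beta> i) \<subseteq> ?L (generator a d i)" if "i \<le> k" for i
  proof -
    consider "i = 0" | "i = k" | "0 < i" "i < k" using \<open>i \<le> k\<close> by linarith
    then show ?thesis
    proof cases
      case 1
      then show ?thesis using k by (simp add: \<beta>_def U_def keys_minus keys_restrict_keys)
    next
      case 2
      have "w \<in> ?L (generator a d k)" if "w \<in> Poly_Mapping.keys (c {0, k})" "w \<notin> U" for w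
        using cover[of w] spec[OF hom, of "{0, k}"] that by (auto simp: homogeneous_def U_def)
      then show ?thesis using 2 k by (auto simp: \<beta>_def keys_restrict_keys)
    next
      case 3
      have ai: "0 < a i" "a i < d" using a(3) 3 by auto
      note incl = monoid_localization_interior[OF a(1,2) ai \<open>i \<le> k\<close>]
      have "Poly_Mapping.keys (c {i, k}) \<subseteq> ?L (generator a d i)"
        by (rule subset_trans[OF keys incl]) (use 3 in auto)
      moreover have "Poly_Mapping.keys (c {i, 0}) \<subseteq> ?L (generator a d i)"
        by (rule subset_trans[OF keys incl]) (use 3 in auto)
      ultimately show ?thesis
        using 3 keys_add[of "- restrict_keys U (c {i, k})" "restrict_keys (- U) (c {0, i})"]
        by (auto simp: \<beta>_def keys_minus keys_restrict_keys insert_commute)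
    qed
  qed
  define b where "b I = (if card I = 1 \<and> I \<subseteq> {..k} then \<beta> (the_elem I) else 0)" for I
  have b: "b {i} = \<beta> i" if "i \<le> k" for i using that by (simp add: b_def)
  have bC: "b \<in> cech_cochains (semigroup_ring (curve_monoid a d k)) (gen_monomial a d) k 1"
    unfolding cech_cochains_iff
  proof
    fix I
    show "Poly_Mapping.keys (b I) \<subseteq>
      (if I \<subseteq> {..k} \<and> card I = 1 then ?L (\<Sum>i\<in>I. generator a d i) else {})"
    proof (cases "I \<subseteq> {..k} \<and> card I = 1")
      case True
      then obtain i where "I = {i}" "i \<le> k" by (auto simp: card_1_singleton_iff)
      then show ?thesis using \<beta> b by simp
    next
      case False
      then show ?thesis by (auto simp: b_def)
    qed
  qed
  have "cech_diff k b J = c J" for J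
  proof (cases "J \<subseteq> {..k} \<and> card J = 2")
    case True
    then obtain i j where J: "J = {i, j}" "i < j" "j \<le> k"
      by (auto simp: card_2_iff) (metis insert_commute linorder_neqE_nat)
    \<comment> \<open>Cocycle identities on \<open>{i, j, k}\<close> and \<open>{0, i, j}\<close>.
      For \<open>j = k\<close> or \<open>i = 0\<close> the contraction at that vertex gives
      \<open>c {i, j}\<close> directly.\<close>
    have upper: "c {i, j} = c {i, k} - c {j, k}" if "j < k"
      using cech_diff_insert3[of i j k k c] dc J that by (simp add: algebra_simps)
    have lower: "c {i, j} = c {0, j} - c {0, i}" if "0 < i"
      using cech_diff_insert3[of 0 i j k c] dc J that by (simp add: algebra_simps)
    have "restrict_keys U (c {i, j}) =
        (if j < k then - restrict_keys U (c {j, k}) else 0) + restrict_keys U (c {i, k})"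
      using J upper by (auto simp: restrict_keys_diff)
    moreover have "restrict_keys (- U) (c {i, j}) =
        restrict_keys (- U) (c {0, j}) - (if 0 < i then restrict_keys (- U) (c {0, i}) else 0)"
      using J lower by (auto simp: restrict_keys_diff)
    ultimately have "\<beta> j - \<beta> i = restrict_keys U (c {i, j}) + restrict_keys (- U) (c {i, j})"
      using J by (simp add: \<beta>_def)
    also have "\<dots> = c {i, j}" by (rule restrict_keys_split)
    finally show ?thesis using J b cech_diff_insert2[of i j k b] by simp
  next
    case False
    then have "c J = 0" by (intro cech_cochains_eq_0[OF c]) (simp add: numeral_2_eq_2)
    moreover have "cech_diff k b J = 0"
    proof (cases "J \<subseteq> {..k}")
      case True
      then have "finite J" by (rule finite_subset) simp
      have "card (J - {j}) \<noteq> 1" if "j \<in> J" for j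
        using that False True \<open>finite J\<close> by (auto simp: card_Diff_singleton)
      then show ?thesis by (intro cech_diff_eq_0) (simp add: b_def)
    qed (simp add: cech_diff_def)
    ultimately show ?thesis by simp
  qed
  then have "cech_diff k b = c" by (rule ext)
  then show False using nb bC by blast
qed

section \<open>Sums of generators\<close>

text \<open>The number of summands is kept because it becomes a degree: \<open>j\<close> generators
  with sum \<open>t\<close> yield the point \<open>(t, j * d - t)\<close> of the curve
  monoid.\<close>

primrec nsums :: "'a::comm_monoid_add set \<Rightarrow> nat \<Rightarrow> 'a set" where
  "nsums A 0 = {0}"
| "nsums A (Suc j) = {x + t | x t. x \<in> A \<and> t \<in> nsums A j}"

lemma nsums_add: "x \<in> nsums A i \<Longrightarrow> y \<in> nsums A j \<Longrightarrow> x + y \<in> nsums A (i + j)"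
  by (induction i arbitrary: x) (auto simp: add.assoc, blast)

text \<open>Bezout, applied along the elements of \<open>A\<close>.\<close>

lemma Gcd_mem_of_subgroup:
  fixes I :: "int set"
  assumes "finite A" "A \<subseteq> I" "0 \<in> I"
    and "\<And>x y u v. x \<in> I \<Longrightarrow> y \<in> I \<Longrightarrow> u * x + v * y \<in> I"
  shows "Gcd A \<in> I"
  using assms(1,2)
proof (induction A)
  case empty
  then show ?case using assms(3) by simp
next
  case (insert x A)
  obtain u v where "u * x + v * Gcd A = gcd x (Gcd A)" using bezout_int by blast
  then show ?case using insert assms(4) by (metis Gcd_insert insert_subset)
qed

text \<open>This is \<open>card_set_mult_iterate\<close> for residues modulo \<open>n\<close>:
  \<open>c\<close> puts the residue \<open>0\<close> into the set, and \<open>Gcd A = 1\<close>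
  makes the set generate, since a subgroup containing it contains the residue of
  \<open>1\<close>.\<close>

lemma ex_nsums_cong:
  fixes A :: "int set" and n :: nat
  assumes n: "n > 0" and A: "finite A" "Gcd A = 1" and c: "c \<in> A" "int n dvd c"
    and big: "2 * n \<le> Suc j * card ((\<lambda>x. x mod int n) ` A)"
  shows "\<exists>t \<in> nsums A j. t mod int n = u mod int n"
proof -
  let ?G = "integer_mod_group n" and ?r = "\<lambda>x. x mod int n"
  interpret G: comm_group ?G by simp
  have carrier: "carrier ?G = {0..<int n}" using n by (simp add: carrier_integer_mod_group)
  let ?B = "?r ` A"
  have "((\<lambda>X. X <#>\<^bsub>?G\<^esub> ?B) ^^ j) {\<one>\<^bsub>?G\<^esub>} = carrier ?G"
  proof (rule G.card_set_mult_iterate)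
    show "finite (carrier ?G)" "?B \<subseteq> carrier ?G" using n by (auto simp: carrier)
    show "\<one>\<^bsub>?G\<^esub> \<in> ?B" using c by force
    show "2 * card (carrier ?G) \<le> Suc j * card ?B" using big by (simp add: carrier)
    fix H assume H: "subgroup H ?G" "?B \<subseteq> H"
    have mult: "(x + y) mod int n \<in> H" if "x \<in> H" "y \<in> H" for x y
      using subgroup.m_closed[OF H(1) that] by simp
    have pow: "(m * x) mod int n \<in> H" if "x \<in> H" for m x
      using G.subgroup_int_pow_closed[OF H(1) that, of m] by (simp add: int_pow_integer_mod_group)
    have "Gcd A \<in> {z. ?r z \<in> H}"
    proof (rule Gcd_mem_of_subgroup[OF A(1)])
      show "A \<subseteq> {z. ?r z \<in> H}" using H(2) by auto
      show "0 \<in> {z. ?r z \<in> H}" using subgroup.one_closed[OF H(1)] by simp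
      fix x y s t assume "x \<in> {z. ?r z \<in> H}" "y \<in> {z. ?r z \<in> H}"
      then have "((s * ?r x) mod int n + (t * ?r y) mod int n) mod int n \<in> H"
        using pow mult by simp
      then show "s * x + t * y \<in> {z. ?r z \<in> H}" by (simp add: mod_simps)
    qed
    then have 1: "1 mod int n \<in> H" using A(2) by simp
    have "z \<in> H" if "z \<in> carrier ?G" for z
      using pow[OF 1, of z] that by (simp add: carrier mod_simps)
    then show "H = carrier ?G" using subgroup.subset[OF H(1)] by blast
  qed
  moreover have "((\<lambda>X. X <#>\<^bsub>?G\<^esub> ?B) ^^ j) {\<one>\<^bsub>?G\<^esub>} = ?r ` nsums A j"
  proof (induction j)
    case (Suc j)
    have "?r ` nsums A j <#>\<^bsub>?G\<^esub> ?B = ?r ` nsums A (Suc j)"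
      unfolding set_mult_def by (force simp: mod_simps add.commute image_iff)
    then show ?case using Suc by simp
  qed simp
  ultimately have "{0..<int n} = ?r ` nsums A j" by (simp add: carrier)
  moreover have "?r u \<in> {0..<int n}" using n by simp
  ultimately have "?r u \<in> ?r ` nsums A j" by blast
  then show ?thesis by auto
qed

text \<open>The hypotheses at one end only, to be instantiated with the sequence and with its
  reversal. As \<open>g\<close> is any bound on the gaps, the same value serves both.\<close>

locale separated_sequence =
  fixes a :: "nat \<Rightarrow> int" and d g :: int and k :: nat
  assumes k: "2 \<le> k" and a0: "a 0 = 0" and ak: "a k = d"
    and less_Suc: "\<And>i. i < k \<Longrightarrow> a i < a (Suc i)"
    and gap: "\<And>i. i < k \<Longrightarrow> a (Suc i) \<le> a i + g + 1"
    and Gcd_1: "Gcd (a ` {1..k}) = 1"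
    and inj_mod: "inj_on (\<lambda>i. a i mod a 1) {1..k}"
begin

section \<open>The numerical semigroup generated by the sequence\<close>

abbreviation gens :: "int set" where "gens \<equiv> a ` {1..k}"

abbreviation semigroup :: "int set" where "semigroup \<equiv> \<Union>j. nsums gens j"

lemma strict_mono: "i < j \<Longrightarrow> j \<le> k \<Longrightarrow> a i < a j"
proof (induction j)
  case (Suc j)
  then show ?case using less_Suc[of j] by (cases "i = j") auto
qed simp

lemma a_mono: "i \<le> j \<Longrightarrow> j \<le> k \<Longrightarrow> a i \<le> a j"
  using strict_mono[of i j] by (cases "i = j") auto

lemma a1_pos: "0 < a 1" using strict_mono[of 0 1] k a0 by simp

text \<open>Pigeonhole on the residues modulo \<open>a 1\<close>.\<close>

lemma k_le_a1: "int k \<le> a 1"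
proof -
  have "card ((\<lambda>i. a i mod a 1) ` {1..k}) \<le> card {0..<a 1}"
    by (rule card_mono) (use a1_pos in auto)
  then show ?thesis using card_image[OF inj_mod] a1_pos by simp
qed

lemma g_nonneg: "0 \<le> g" using less_Suc[of 0] gap[of 0] k by simp

lemma k_le_d: "int k \<le> d" and a1_less_d: "a 1 < d"
  using k_le_a1 strict_mono[of 1 k] k ak by auto

lemma gens_bounds: "x \<in> gens \<Longrightarrow> a 1 \<le> x \<and> x \<le> d"
  using a_mono ak by force

lemma nsums_bounds: "t \<in> nsums gens j \<Longrightarrow> int j * a 1 \<le> t \<and> t \<le> int j * d"
proof (induction j arbitrary: t)
  case (Suc j)
  then obtain x s where "t = x + s" "x \<in> gens" "s \<in> nsums gens j" by auto
  then have "int j * a 1 \<le> s" "s \<le> int j * d" "a 1 \<le> x" "x \<le> d"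
    using Suc.IH gens_bounds by blast+
  moreover have "int (Suc j) * a 1 = int j * a 1 + a 1" "int (Suc j) * d = int j * d + d"
    by (simp_all add: distrib_right)
  ultimately show ?case using \<open>t = x + s\<close> by linarith
qed simp

lemma nsums_a1: "int j * a 1 \<in> nsums gens j"
proof (induction j)
  case (Suc j)
  moreover have "a 1 \<in> gens" using k by auto
  ultimately show ?case by (force simp: algebra_simps)
qed simp

text \<open>The ceiling of \<open>2 * a 1 / k\<close> minus one: the least number that meets the
  size condition of \<open>ex_nsums_cong\<close> for \<open>k\<close> distinct residues modulo
  \<open>a 1\<close>.\<close>

definition m :: nat where "m = nat ((2 * a 1 - 1) div int k)"

lemma m_upper: "int m * int k \<le> 2 * a 1 - 1"
proof -
  have "int m = (2 * a 1 - 1) div int k" using a1_pos k by (simp add: m_def pos_imp_zdiv_nonneg_iff)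
  then have "int m * int k = (2 * a 1 - 1) div int k * int k" by simp
  moreover have "(2 * a 1 - 1) div int k * int k + (2 * a 1 - 1) mod int k = 2 * a 1 - 1"
    by (rule div_mult_mod_eq)
  moreover have "0 \<le> (2 * a 1 - 1) mod int k" using k by simp
  ultimately show ?thesis by linarith
qed

lemma m_lower: "2 * a 1 \<le> (int m + 1) * int k"
proof -
  have "2 * a 1 - 1 = (2 * a 1 - 1) div int k * int k + (2 * a 1 - 1) mod int k"
    by (rule div_mult_mod_eq[symmetric])
  moreover have "(2 * a 1 - 1) mod int k < int k" using k by simp
  moreover have "int m = (2 * a 1 - 1) div int k" using a1_pos k by (simp add: m_def pos_imp_zdiv_nonneg_iff)
  then have "int m * int k = (2 * a 1 - 1) div int k * int k" by simp
  ultimately have "2 * a 1 \<le> int m * int k + int k" by linarith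
  then show ?thesis by (simp add: distrib_right)
qed

definition conductor :: int where "conductor = int m * d - a 1 + 1"

text \<open>Some sum \<open>t\<close> of \<open>m\<close> generators is congruent to
  \<open>u\<close> modulo \<open>a 1\<close>. As \<open>t \<le> m * d\<close>, the difference
  \<open>u - t\<close> exceeds \<open>- a 1\<close>; being a multiple of \<open>a 1\<close>, it is
  nonnegative and is made up of copies of \<open>a 1\<close>.\<close>

lemma conductor_semigroup:
  assumes "conductor \<le> u"
  shows "u \<in> semigroup"
proof -
  define n where "n = nat (a 1)"
  have n: "int n = a 1" "n > 0" using a1_pos by (auto simp: n_def)
  have "card ((\<lambda>x. x mod int n) ` gens) = k"
    using card_image[OF inj_mod] by (simp add: image_image n)
  moreover have "2 * n \<le> Suc m * k"
  proof -
    have "int (2 * n) \<le> int (Suc m * k)" using m_lower n by (simp add: algebra_simps)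
    then show ?thesis by linarith
  qed
  ultimately obtain t where t: "t \<in> nsums gens m" "t mod a 1 = u mod a 1"
    using ex_nsums_cong[of n gens "a 1" m u] n Gcd_1 k by auto
  obtain c where c: "u - t = a 1 * c" using t(2) by (metis mod_eq_dvd_iff dvdE)
  have "- a 1 < a 1 * c" using nsums_bounds[OF t(1)] assms c by (simp add: conductor_def)
  have "0 \<le> c"
  proof (rule ccontr)
    assume "\<not> 0 \<le> c"
    then have "a 1 * c \<le> a 1 * (- 1)" using a1_pos by (intro mult_left_mono) auto
    then show False using \<open>- a 1 < a 1 * c\<close> by simp
  qed
  then have "t + int (nat c) * a 1 = u" using c by (simp add: algebra_simps)
  then show ?thesis using nsums_add[OF t(1) nsums_a1[of "nat c"]] by auto
qed

text \<open>An element \<open>u < conductor + d\<close> that is not small lies above some \<open>a i\<close> for which \<open>u - a i\<close> is just above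
  the conductor. So it needs few summands, because each of them is at least \<open>a 1\<close>.\<close>

lemma ex_short_sum:
  assumes "u \<in> semigroup"
  shows "\<exists>q l t. 0 \<le> q \<and> t \<in> nsums gens l \<and> u = q * d + t \<and> int l * int k \<le> 2 * d + g"
proof -
  have d: "0 < d" using a1_pos a1_less_d by simp
  have length_bound: "int l * int k \<le> 2 * d + g" if "int l * a 1 \<le> conductor + g + a 1" for l
  proof -
    have "(int l * int k) * a 1 = (int l * a 1) * int k" by simp
    also have "\<dots> \<le> (int m * d + 1 + g) * int k"
      using that by (intro mult_right_mono) (auto simp: conductor_def)
    also have "\<dots> = (int m * int k) * d + (1 + g) * int k" by (simp add: algebra_simps)
    also have "\<dots> \<le> (2 * a 1 - 1) * d + (1 + g) * int k"
      using m_upper d by (intro add_right_mono mult_right_mono) auto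
    \<comment> \<open>The \<open>- 1\<close> from \<open>m_upper\<close> leaves room for one
      \<open>d\<close>, which absorbs \<open>k\<close>; the term with \<open>g\<close> uses
      \<open>k \<le> a 1\<close>.\<close>
    also have "\<dots> \<le> (2 * a 1 - 1) * d + d + g * a 1"
      using k_le_d mult_left_mono[OF k_le_a1 g_nonneg] by (simp add: algebra_simps)
    also have "\<dots> = (2 * d + g) * a 1" by (simp add: algebra_simps)
    finally show ?thesis using a1_pos by simp
  qed
  have nonneg: "0 \<le> u" if s: "u \<in> semigroup" for u
  proof -
    obtain j where "u \<in> nsums gens j" using s by blast
    then have "int j * a 1 \<le> u" using nsums_bounds by blast
    moreover have "0 \<le> int j * a 1" using a1_pos by simp
    ultimately show ?thesis by linarith
  qed
  show ?thesis using assms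
  proof (induction "nat u" arbitrary: u rule: less_induct)
    case less
    consider "u \<le> conductor + g" | "conductor + g < u" "u < conductor + d" | "conductor + d \<le> u"
      by linarith
    then show ?case
    proof cases
      case 1
      obtain l where l: "u \<in> nsums gens l" using less.prems by auto
      then have "int l * a 1 \<le> conductor + g + a 1" using nsums_bounds[OF l] 1 a1_pos by linarith
      then show ?thesis using l length_bound[of l] by (metis add_0 mult_zero_left order_refl)
    next
      case 2
      \<comment> \<open>The largest \<open>a i\<close> that can be subtracted without falling below
        \<open>conductor\<close>. The next one would overshoot, so \<open>u - a i\<close> is at most
        \<open>conductor + g\<close>. The bounds of this case exclude \<open>i = k\<close> and
        \<open>i = 0\<close>.\<close>
      define i where "i = Max {i. i \<le> k \<and> a i \<le> u - conductor}"
      have "i \<in> {i. i \<le> k \<and> a i \<le> u - conductor}"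
        unfolding i_def by (rule Max_in) (use 2 g_nonneg a0 in \<open>auto intro: exI[of _ 0]\<close>)
      then have i: "i \<le> k" "a i \<le> u - conductor" by auto
      have "i \<noteq> k" using i 2 ak by auto
      have "\<not> a (Suc i) \<le> u - conductor"
      proof
        assume "a (Suc i) \<le> u - conductor"
        then have "Suc i \<le> i" unfolding i_def
          by (intro Max_ge) (use i \<open>i \<noteq> k\<close> in \<open>auto simp: i_def\<close>)
        then show False by simp
      qed
      then have upper: "u - a i \<le> conductor + g" using gap[of i] i \<open>i \<noteq> k\<close> by simp
      have "i \<noteq> 0" using upper 2 a0 by (intro notI) simp
      then have ai: "a i \<in> gens" using i by auto
      obtain l where l: "u - a i \<in> nsums gens l" using conductor_semigroup[of "u - a i"] i by auto
      have "int (Suc l) * a 1 \<le> conductor + g + a 1"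
        using nsums_bounds[OF l] upper by (simp add: algebra_simps)
      moreover have "u \<in> nsums gens (Suc l)" using ai l by force
      ultimately show ?thesis
        using length_bound[of "Suc l"] by (metis add_0 mult_zero_left order_refl)
    next
      case 3
      \<comment> \<open>Copies of \<open>d\<close> are counted in \<open>q\<close> and not in
        \<open>l\<close>: the last generator is \<open>(d, 0)\<close> and adds nothing to the second
        coordinate.\<close>
      have s: "u - d \<in> semigroup" using conductor_semigroup 3 by simp
      have "nat (u - d) < nat u" using nonneg[OF s] d by simp
      then obtain q l t where "0 \<le> q" "t \<in> nsums gens l" "u - d = q * d + t"
        "int l * int k \<le> 2 * d + g" using less.hyps s by blast
      then show ?thesis
        by (intro exI[of _ "q + 1"] exI[of _ l] exI[of _ t]) (auto simp: algebra_simps)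
    qed
  qed
qed

section \<open>From the numerical semigroup to the curve monoid\<close>

lemma nsums_curve_monoid: "t \<in> nsums gens j \<Longrightarrow> (t, int j * d - t) \<in> curve_monoid a d k"
proof (induction j arbitrary: t)
  case 0
  then show ?case
    using generated_monoid.zero[of "generator a d ` {..k}"] by (simp add: curve_monoid_def zero_prod_def)
next
  case (Suc j)
  then obtain i s where s: "t = a i + s" "i \<le> k" "s \<in> nsums gens j" by auto
  then have "generator a d i + (s, int j * d - s) \<in> curve_monoid a d k"
    using Suc.IH[of s] unfolding curve_monoid_def by (intro generated_monoid.add) auto
  then show ?case using s by (simp add: generator_def algebra_simps)
qed

lemma curve_monoid_fst: "w \<in> curve_monoid a d k \<Longrightarrow> fst w \<in> semigroup"
  unfolding curve_monoid_def
proof (induction rule: generated_monoid.induct)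
  case zero
  show ?case by (auto intro: exI[of _ 0])
next
  case (add g w)
  then obtain i j where i: "i \<le> k" "g = generator a d i" and j: "fst w \<in> nsums gens j" by auto
  show ?case
  proof (cases "i = 0")
    case True
    then show ?thesis using i j a0 by (auto simp: generator_def)
  next
    case False
    then have "a i \<in> gens" using i by auto
    then have "a i + fst w \<in> nsums gens (Suc j)" using j by auto
    then show ?thesis using i by (auto simp: generator_def simp del: nsums.simps)
  qed
qed

text \<open>With \<open>u = q * d + t\<close> from \<open>ex_short_sum\<close>, the point
  \<open>(u, l * d - t)\<close> lies in the curve monoid. Adding copies of \<open>(0, d)\<close>
  would reach \<open>(u, v)\<close> if \<open>v\<close> were at least \<open>l * d - t\<close>. So
  \<open>v < l * d - t \<le> l * (d - a 1)\<close>, and \<open>l\<close> is small.\<close>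

lemma notin_curve_monoid_snd_bound:
  assumes u: "u \<in> semigroup" and dvd: "d dvd u + v" and notin: "(u, v) \<notin> curve_monoid a d k"
  shows "v * int k < (2 * d + g) * (d - a 1)"
proof -
  obtain q l t where q: "0 \<le> q" "t \<in> nsums gens l" "u = q * d + t" and l: "int l * int k \<le> 2 * d + g"
    using ex_short_sum[OF u] by blast
  have d: "0 < d" using a1_pos a1_less_d by simp
  define c where "c = v - (int l * d - t)"
  have "c = (u + v) - (q + int l) * d" using q(3) by (simp add: c_def algebra_simps)
  then have "d dvd c" using dvd by (simp add: dvd_diff)
  then obtain e where e: "c = d * e" ..
  have "c < 0"
  proof (rule ccontr)
    assume "\<not> c < 0"
    then have "0 \<le> e" using e d by (simp add: zero_le_mult_iff mult_less_0_iff not_less)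
    have c': "v = int l * d - t + e * d" using e by (simp add: c_def algebra_simps)
    have "(int (nat q) * a k, int (nat q) * (d - a k)) + ((t, int l * d - t)
        + (int (nat e) * a 0, int (nat e) * (d - a 0))) \<in> curve_monoid a d k"
      by (intro curve_monoid_add curve_monoid_multiple nsums_curve_monoid[OF q(2)]) auto
    moreover have "int (nat q) * a k + (t + int (nat e) * a 0) = u"
      "int (nat q) * (d - a k) + (int l * d - t + int (nat e) * (d - a 0)) = v"
      using q \<open>0 \<le> e\<close> a0 ak c' by simp_all
    ultimately have "(u, v) \<in> curve_monoid a d k" by simp
    then show False using notin by simp
  qed
  then have "v < int l * (d - a 1)" using nsums_bounds[OF q(2)] by (simp add: c_def algebra_simps)
  then have "v * int k < int l * (d - a 1) * int k" using k by simp
  also have "\<dots> = int l * int k * (d - a 1)" by simp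
  also have "\<dots> \<le> (2 * d + g) * (d - a 1)" using l a1_less_d by (intro mult_right_mono) auto
  finally show ?thesis .
qed

lemma in_semigroup_curve_monoid:
  assumes u: "u \<in> semigroup" and dvd: "d dvd u + v"
  shows "\<exists>N. (u, v + int N * d) \<in> curve_monoid a d k"
proof -
  obtain j where j: "u \<in> nsums gens j" using u by auto
  have d: "0 < d" using a1_pos a1_less_d by simp
  obtain e where e: "u + v = d * e" using dvd ..
  \<comment> \<open>\<open>N\<close> and \<open>M\<close> are the positive and negative parts of
    \<open>j - e\<close>: depending on its sign, copies of \<open>(0, d)\<close> are added to
    \<open>(u, v)\<close> or to the point coming from the representation of
    \<open>u\<close>.\<close>
  define N where "N = nat (int j - e)"
  define M where "M = nat (e - int j)"
  have "(u, int j * d - u) + (int M * a 0, int M * (d - a 0)) \<in> curve_monoid a d k"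
    by (intro curve_monoid_add curve_monoid_multiple nsums_curve_monoid[OF j]) auto
  moreover have "int j * d - u + int M * d = v + int N * d"
  proof -
    have "int j + int M = e + int N" by (simp add: M_def N_def)
    then have "(int j + int M) * d = (e + int N) * d" by simp
    then show ?thesis using e by (simp add: algebra_simps)
  qed
  ultimately show ?thesis using a0 by auto
qed

end

section \<open>Reversal of the sequence\<close>

lemma reflect_generator:
  assumes "i \<le> k"
  shows "generator (\<lambda>i. d - a (k - i)) d (k - i) = prod.swap (generator a d i)"
  using assms by (simp add: generator_def)

lemma swap_curve_monoid:
  "w \<in> curve_monoid a d k \<Longrightarrow> prod.swap w \<in> curve_monoid (\<lambda>i. d - a (k - i)) d k"
  unfolding curve_monoid_def
proof (induction rule: generated_monoid.induct)
  case zero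
  then show ?case using generated_monoid.zero[of "generator (\<lambda>i. d - a (k - i)) d ` {..k}"]
    by (simp add: zero_prod_def)
next
  case (add g w)
  then obtain i where i: "i \<le> k" "g = generator a d i" by auto
  have "generator (\<lambda>i. d - a (k - i)) d (k - i) + prod.swap w
      \<in> generated_monoid (generator (\<lambda>i. d - a (k - i)) d ` {..k})"
    using add.IH by (intro generated_monoid.add) auto
  then show ?case unfolding reflect_generator[OF i(1)] i(2) by (simp add: prod.swap_def plus_prod_def)
qed

lemma curve_monoid_reflect:
  assumes "(v, u) \<in> curve_monoid (\<lambda>i. d - a (k - i)) d k"
  shows "(u, v) \<in> curve_monoid a d k"
proof -
  \<comment> \<open>Reversing twice is only known to restore \<open>a\<close> on
    \<open>{..k}\<close>, so the sets of generators are compared instead of the sequences.\<close>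
  have "generator (\<lambda>i. d - (d - a (k - (k - i)))) d ` {..k} = generator a d ` {..k}"
    by (rule image_cong) (auto simp: generator_def)
  then show ?thesis using swap_curve_monoid[OF assms] by (simp add: curve_monoid_def)
qed

section \<open>The degree bounds\<close>

lemma monoid_localization_reflect:
  assumes "w \<in> monoid_localization (curve_monoid a d k) (generator a d k)"
  shows "prod.swap w \<in> monoid_localization (curve_monoid (\<lambda>i. d - a (k - i)) d k)
    (generator (\<lambda>i. d - a (k - i)) d 0)"
proof -
  obtain N where "w + nat_mul N (generator a d k) \<in> curve_monoid a d k"
    using assms by (auto simp: monoid_localization_def)
  from swap_curve_monoid[OF this]
  show ?thesis
    by (cases w) (auto simp: monoid_localization_def nat_mul_def generator_def intro!: exI[of _ N])
qed

lemma monoid_localization_unreflect: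
  assumes "(v, u) \<in> monoid_localization (curve_monoid (\<lambda>i. d - a (k - i)) d k)
    (generator (\<lambda>i. d - a (k - i)) d 0)"
  shows "(u, v) \<in> monoid_localization (curve_monoid a d k) (generator a d k)"
proof -
  obtain N where "(v, u) + nat_mul N (generator (\<lambda>i. d - a (k - i)) d 0)
      \<in> curve_monoid (\<lambda>i. d - a (k - i)) d k"
    using assms by (auto simp: monoid_localization_def)
  then have "(v + int N * (d - a k), u + int N * a k) \<in> curve_monoid (\<lambda>i. d - a (k - i)) d k"
    by (simp add: nat_mul_def generator_def)
  from curve_monoid_reflect[OF this] show ?thesis
    by (auto simp: monoid_localization_def nat_mul_def generator_def intro!: exI[of _ N])
qed

text \<open>Inverting the generator \<open>(0, d)\<close> frees the second coordinate up to
  multiples of \<open>d\<close>, so under the divisibility condition the first coordinate alone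
  decides.\<close>

lemma (in separated_sequence) monoid_localization_0_iff:
  assumes "d dvd u + v"
  shows "(u, v) \<in> monoid_localization (curve_monoid a d k) (generator a d 0) \<longleftrightarrow> u \<in> semigroup"
proof
  assume "(u, v) \<in> monoid_localization (curve_monoid a d k) (generator a d 0)"
  then obtain N where "(u, v) + nat_mul N (generator a d 0) \<in> curve_monoid a d k"
    by (auto simp: monoid_localization_def)
  from curve_monoid_fst[OF this] show "u \<in> semigroup"
    using a0 by (simp add: nat_mul_def generator_def)
next
  assume "u \<in> semigroup"
  then obtain N where "(u, v + int N * d) \<in> curve_monoid a d k"
    using in_semigroup_curve_monoid assms by blast
  then show "(u, v) \<in> monoid_localization (curve_monoid a d k) (generator a d 0)"
    using a0 by (auto simp: monoid_localization_def nat_mul_def generator_def)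
qed

text \<open>Reversal turns the modulus \<open>d - a (k - 1)\<close> of the upper end into the first
  positive member of a sequence, so each one-sided result also bounds the other coordinate.\<close>

locale two_sided_sequence = separated_sequence +
  assumes reflected: "separated_sequence (\<lambda>i. d - a (k - i)) d g k"
begin

text \<open>A nonzero class yields a missing point \<open>(u, v)\<close> that lies in both extremal
  localizations. The one-sided bound then applies to \<open>v\<close> with factor
  \<open>d - a 1\<close> and, after reversal, to \<open>u\<close> with factor
  \<open>a (k - 1)\<close>; the two are added.\<close>

lemma local_cohomology_1_bound:
  assumes "(local_cohomology a d k 1 n :: (nat set \<Rightarrow> _ \<Rightarrow>\<^sub>0 'k::field) set set)
    \<noteq> local_cohomology_zero a d k 1"
  shows "d * n * int k < (2 * d + g) * (d + (a (k - 1) - a 1))"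
proof -
  interpret R: separated_sequence "\<lambda>i. d - a (k - i)" d g k by (rule reflected)
  have "0 < k" using k by simp
  then obtain u v where uv: "u + v = d * n" "(u, v) \<notin> curve_monoid a d k"
    and 0: "(u, v) \<in> monoid_localization (curve_monoid a d k) (generator a d 0)"
    and 1: "(u, v) \<in> monoid_localization (curve_monoid a d k) (generator a d k)"
    using local_cohomology_1_zero[of k d n a] assms by fastforce
  have dvd: "d dvd u + v" "d dvd v + u" using uv(1) by (auto simp: add.commute)
  have "u \<in> semigroup" using 0 monoid_localization_0_iff dvd by blast
  then have "v * int k < (2 * d + g) * (d - a 1)"
    using notin_curve_monoid_snd_bound dvd uv(2) by blast
  moreover have "v \<in> R.semigroup"
    using monoid_localization_reflect[OF 1] R.monoid_localization_0_iff[OF dvd(2)] by simp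
  then have "u * int k < (2 * d + g) * (d - (d - a (k - 1)))"
    using R.notin_curve_monoid_snd_bound[OF _ dvd(2)] curve_monoid_reflect uv(2) by blast
  moreover have "d * n * int k = u * int k + v * int k"
    by (simp add: uv(1) flip: distrib_right)
  ultimately show ?thesis by (simp add: algebra_simps)
qed

text \<open>A nonzero class yields \<open>(u, v)\<close> outside both extremal localizations, so
  both coordinates lie below their conductor bounds. The summand \<open>d\<close> in the second of
  these bounds turns \<open>n\<close> into \<open>n + 1\<close>, as the shift by \<open>2\<close> in
  the regularity demands.\<close>

lemma local_cohomology_2_bound:
  assumes "(local_cohomology a d k 2 n :: (nat set \<Rightarrow> _ \<Rightarrow>\<^sub>0 'k::field) set set)
    \<noteq> local_cohomology_zero a d k 2"
  shows "d * (n + 1) * int k \<le> (2 * d + g) * (d + (a (k - 1) - a 1))"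
proof -
  interpret R: separated_sequence "\<lambda>i. d - a (k - i)" d g k by (rule reflected)
  have "0 < k" using k by simp
  moreover have "0 < a i \<and> a i < d" if "0 < i" "i < k" for i
    using strict_mono[of 0 i] strict_mono[of i k] that a0 ak by simp
  ultimately obtain u v where uv: "u + v = d * n"
    and 0: "(u, v) \<notin> monoid_localization (curve_monoid a d k) (generator a d 0)"
    and 1: "(u, v) \<notin> monoid_localization (curve_monoid a d k) (generator a d k)"
    using local_cohomology_2_zero[of k a d n] assms a0 ak by fastforce
  have dvd: "d dvd u + v" "d dvd v + u" using uv(1) by (auto simp: add.commute)
  define D where "D = a (k - 1) - a 1"
  have D: "0 \<le> D" using a_mono[of 1 "k - 1"] k by (simp add: D_def)
  have d: "0 < d" using a1_pos a1_less_d by simp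
  have "u \<notin> semigroup" using 0 monoid_localization_0_iff[OF dvd(1)] by blast
  then have u: "u \<le> int m * d - a 1"
    using conductor_semigroup[of u] by (force simp: conductor_def)
  have "v \<notin> R.semigroup"
    using 1 monoid_localization_unreflect R.monoid_localization_0_iff[OF dvd(2)] by blast
  then have v: "v \<le> int R.m * d - (d - a (k - 1))"
    using R.conductor_semigroup[of v] by (force simp: R.conductor_def)
  have "d * (n + 1) \<le> (int m + int R.m) * d + D"
    using u v uv by (simp add: D_def algebra_simps)
  then have "d * (n + 1) * int k \<le> ((int m + int R.m) * d + D) * int k"
    by (intro mult_right_mono) auto
  also have "\<dots> = (int m * int k + int R.m * int k) * d + D * int k" by (simp add: algebra_simps)
  also have "\<dots> \<le> (2 * d) * d + D * d"
  proof (intro add_mono mult_right_mono mult_left_mono)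
    \<comment> \<open>The two upper bounds add up to less than
      \<open>2 * a 1 + 2 * (d - a (k - 1)) = 2 * (d - D)\<close>.\<close>
    show "int m * int k + int R.m * int k \<le> 2 * d"
      using m_upper R.m_upper D by (simp add: D_def)
  qed (use D d k_le_d in auto)
  also have "\<dots> \<le> (2 * d + g) * (d + D)"
  proof -
    have "0 \<le> D * d + g * (d + D)" using D d g_nonneg by simp
    then show ?thesis by (simp add: algebra_simps)
  qed
  finally show ?thesis by (simp add: D_def)
qed

lemma a_invariant_bounds:
  defines "\<beta> \<equiv> (2 * of_int d + of_int g) / of_nat k * (1 + of_int (a (k - 1) - a 1) / of_int d) :: real"
  shows "a_invariant TYPE('k::field) a d k 1 < ereal \<beta>"
    and "a_invariant TYPE('k) a d k 2 \<le> ereal (\<beta> - 1)"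
proof -
  have pos: "0 < d" "0 < k" using a1_pos a1_less_d k by auto
  have \<beta>: "\<beta> * (of_int d * of_nat k) = of_int ((2 * d + g) * (d + (a (k - 1) - a 1)))"
    using pos by (simp add: \<beta>_def field_simps)
  have 1: "of_int n < \<beta>" if "(local_cohomology a d k 1 n :: (nat set \<Rightarrow> _ \<Rightarrow>\<^sub>0 'k) set set)
    \<noteq> local_cohomology_zero a d k 1" for n
  proof -
    have "of_int (d * n * int k) < \<beta> * (of_int d * of_nat k)"
      unfolding \<beta> using local_cohomology_1_bound[OF that] by (simp only: of_int_less_iff)
    then have "of_int n * (of_int d * of_nat k) < \<beta> * (of_int d * of_nat k)" by (simp add: mult_ac)
    then show ?thesis using pos by (simp add: mult_less_cancel_right_pos)
  qed
  have 2: "of_int n + 1 \<le> \<beta>" if "(local_cohomology a d k 2 n :: (nat set \<Rightarrow> _ \<Rightarrow>\<^sub>0 'k) set set)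
    \<noteq> local_cohomology_zero a d k 2" for n
  proof -
    have "of_int (d * (n + 1) * int k) \<le> \<beta> * (of_int d * of_nat k)"
      unfolding \<beta> using local_cohomology_2_bound[OF that] by (simp only: of_int_le_iff)
    then have "(of_int n + 1) * (of_int d * of_nat k) \<le> \<beta> * (of_int d * of_nat k)"
      by (simp add: mult_ac)
    then show ?thesis using pos by (simp add: mult_le_cancel_right_pos)
  qed
  \<comment> \<open>A supremum of numbers below \<open>\<beta>\<close> could equal
    \<open>\<beta>\<close>; the degrees are integers, so \<open>\<lceil>\<beta>\<rceil> - 1\<close>
    bounds them and keeps the inequality strict.\<close>
  have "a_invariant TYPE('k) a d k 1 \<le> ereal (of_int (\<lceil>\<beta>\<rceil> - 1))"
    unfolding a_invariant_def
  proof (rule Sup_least)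
    fix x assume "x \<in> {ereal (of_int n) | n.
            (local_cohomology a d k 1 n :: (nat set \<Rightarrow> (int \<times> int) \<Rightarrow>\<^sub>0 'k) set set)
              \<noteq> local_cohomology_zero a d k 1}"
    then obtain n where "x = ereal (of_int n)" "of_int n < \<beta>" using 1 by blast
    then have "n \<le> \<lceil>\<beta>\<rceil> - 1" by (simp add: less_ceiling_iff)
    then show "x \<le> ereal (of_int (\<lceil>\<beta>\<rceil> - 1))"
      unfolding \<open>x = _\<close> ereal_less_eq of_int_le_iff .
  qed
  also have "\<dots> < ereal \<beta>" by simp linarith
  finally show "a_invariant TYPE('k) a d k 1 < ereal \<beta>" .
  show "a_invariant TYPE('k) a d k 2 \<le> ereal (\<beta> - 1)"
    unfolding a_invariant_def using 2 by (intro Sup_least) fastforce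
qed

end

theorem theorem4p13:
  fixes a :: "nat \<Rightarrow> int" and d :: int and k :: nat
  assumes "3 \<le> k"
    and "a 0 = 0" and "a k = d"
    and "\<forall>i<k. a i < a (Suc i)"
    and "Gcd (a ` {1..k}) = 1"
    and "\<forall>i\<in>{1..k}. \<forall>j\<in>{1..k}. i \<noteq> j \<longrightarrow> \<not> [a i = a j] (mod a 1)"
    and "\<forall>i\<in>{0..k-1}. \<forall>j\<in>{0..k-1}. i \<noteq> j \<longrightarrow> \<not> [a i = a j] (mod (d - a (k-1)))"
  shows "a_invariant TYPE('k::field) a d k 1 <
      ereal ((2 * of_int d + of_int (largest_gap a k)) / of_nat k
              * (1 + of_int (a (k-1) - a 1) / of_int d)) \<and>
    regularity TYPE('k) a d k \<le>
      ereal (1 + (2 * of_int d + of_int (largest_gap a k)) / of_nat k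
              * (1 + of_int (a (k-1) - a 1) / of_int d))"
proof -
  let ?a' = "\<lambda>i. d - a (k - i)" and ?g = "largest_gap a k"
  have gap: "a (Suc i) \<le> a i + ?g + 1" if "i < k" for i
  proof -
    have "a (Suc i) - a (Suc i - 1) - 1 \<le> ?g"
      unfolding largest_gap_def by (rule Max_ge) (use that in \<open>auto intro!: image_eqI[of _ _ "Suc i"]\<close>)
    then show ?thesis by simp
  qed
  have "separated_sequence a d ?g k"
  proof
    show "inj_on (\<lambda>i. a i mod a 1) {1..k}"
      using assms(6) unfolding inj_on_def cong_def by blast
  qed (use assms gap in auto)
  moreover have "separated_sequence ?a' d ?g k"
  proof
    show "2 \<le> k" "?a' 0 = 0" "?a' k = d" using assms by auto
    fix i assume "i < k"
    then have "k - Suc i < k" "Suc (k - Suc i) = k - i" by auto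
    then show "?a' i < ?a' (Suc i)" "?a' (Suc i) \<le> ?a' i + ?g + 1"
      using assms(4) gap[of "k - Suc i"] by (metis diff_strict_left_mono, simp)
  next
    let ?G = "Gcd (?a' ` {1..k})"
    have dvd: "?G dvd ?a' i" if "1 \<le> i" "i \<le> k" for i
      using that by (intro Gcd_dvd) auto
    \<comment> \<open>The last member of the reversed sequence is \<open>d\<close>, so its common
      divisors divide each \<open>a i = d - (d - a i)\<close>.\<close>
    have "?G dvd d" using dvd[of k] assms(1,2) by simp
    have "?G dvd a i" if "i \<in> {1..k}" for i
    proof (cases "i = k")
      case False
      then have "i < k" using that by simp
      then have "?G dvd d - a i" using dvd[of "k - i"] by simp
      from dvd_diff[OF \<open>?G dvd d\<close> this] show ?thesis by simp
    qed (use \<open>?G dvd d\<close> assms(3) in simp)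
    then have "?G dvd Gcd (a ` {1..k})" by (auto intro: Gcd_greatest)
    then show "?G = 1" using assms(5) by simp
  next
    \<comment> \<open>The map \<open>i \<mapsto> k - i\<close> carries \<open>{1..k}\<close> to
      \<open>{0..k-1}\<close>, the index range of the second congruence hypothesis.\<close>
    show "inj_on (\<lambda>i. ?a' i mod ?a' 1) {1..k}"
    proof (rule inj_onI)
      fix i j assume ij: "i \<in> {1..k}" "j \<in> {1..k}" "?a' i mod ?a' 1 = ?a' j mod ?a' 1"
      then have "?a' 1 dvd a (k - j) - a (k - i)" by (simp add: mod_eq_dvd_iff)
      then have "[a (k - j) = a (k - i)] (mod (d - a (k - 1)))" by (simp add: cong_iff_dvd_diff)
      then have "k - j = k - i" using assms(7) ij by (metis atLeastAtMost_iff diff_le_mono2 zero_le)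
      then show "i = j" using ij by auto
    qed
  qed
  ultimately interpret two_sided_sequence a d ?g k
    by (simp add: two_sided_sequence_def two_sided_sequence_axioms_def)
  define \<beta> where "\<beta> = (2 * of_int d + of_int ?g) / of_nat k * (1 + of_int (a (k-1) - a 1) / of_int d :: real)"
  note bounds = a_invariant_bounds[where 'k = 'k, folded \<beta>_def]
  \<comment> \<open>Both terms of the maximum get the same bound, since
    \<open>\<beta> + 1 = (\<beta> - 1) + 2\<close>.\<close>
  have "a_invariant TYPE('k) a d k 1 + 1 \<le> ereal \<beta> + 1"
    using bounds(1) by (intro add_right_mono) simp
  moreover have "a_invariant TYPE('k) a d k 2 + 2 \<le> ereal (\<beta> - 1) + 2"
    using bounds(2) by (intro add_right_mono)
  ultimately have "regularity TYPE('k) a d k \<le> ereal (1 + \<beta>)"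
    by (simp add: regularity_def add.commute numeral_eq_ereal one_ereal_def)
  then show ?thesis using bounds(1) unfolding \<beta>_def by blast
qed

end
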